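(* Let $G$ be a non-archimedean Polish group. Then the greatest ambit $S(G)$ is isomorphic as a $G$-space to the inverse limit of an inverse system (over a directed set, with continuous equivariant bonding maps) of compact metrizable zero-dimensional $G$-spaces. If moreover $G$ is infinite, there exists such an inverse system in which every $G$-space is homeomorphic to the Cantor space $\{0,1\}^{\mathbb N}$.
   Context: A Polish group is a separable completely metrizable topological group. A topological group is non-archimedean if it is Hausdorff and has a neighbourhood base at the identity consisting of open subgroups. The greatest ambit $S(G)$ is the Gelfand spectrum of the C*-algebra $RUCB(G)$ of bounded right uniformly continuous complex functions on $G$, with the continuous $G$-action $(g\cdot\varphi)(x)=\varphi(g^{-1}\cdot x)$ where $(g\cdot x)(h)=x(g^{-1}h)$. A $G$-space is a space with a continuous $G$-action; zero-dimensional means Lebesgue covering dimension $0$. *)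

theory Defs
  imports "HOL-Analysis.Analysis" "HOL-Algebra.Group"
begin

definition topological_group :: "'g monoid \<Rightarrow> 'g topology \<Rightarrow> bool" where
  "topological_group G T \<longleftrightarrow>
     group G \<and> topspace T = carrier G \<and>
     continuous_map (prod_topology T T) T (\<lambda>(x, y). x \<otimes>\<^bsub>G\<^esub> y) \<and>
     continuous_map T T (\<lambda>x. inv\<^bsub>G\<^esub> x)"

definition Polish_space :: "'a topology \<Rightarrow> bool" where
  "Polish_space X \<longleftrightarrow> separable_space X \<and> completely_metrizable_space X"

definition Polish_group :: "'g monoid \<Rightarrow> 'g topology \<Rightarrow> bool" where
  "Polish_group G T \<longleftrightarrow> topological_group G T \<and> Polish_space T"

definition non_archimedean :: "'g monoid \<Rightarrow> 'g topology \<Rightarrow> bool" where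
  "non_archimedean G T \<longleftrightarrow> topological_group G T \<and> Hausdorff_space T \<and>
     (\<forall>U. openin T U \<and> \<one>\<^bsub>G\<^esub> \<in> U \<longrightarrow>
        (\<exists>H. subgroup H G \<and> openin T H \<and> H \<subseteq> U))"

text \<open>Functions are represented as total functions vanishing outside the carrier.
  Right uniform continuity: for every e>0 there is a neighbourhood V of 1 such that
  x y^-1 in V implies |f x - f y| < e (equivalently, left translation is norm continuous).\<close>
definition RUCB :: "'g monoid \<Rightarrow> 'g topology \<Rightarrow> ('g \<Rightarrow> complex) set" where
  "RUCB G T = {f. (\<forall>x. x \<notin> carrier G \<longrightarrow> f x = 0) \<and>
      bounded (f ` carrier G) \<and>
      (\<forall>e>0. \<exists>V. openin T V \<and> \<one>\<^bsub>G\<^esub> \<in> V \<and>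
         (\<forall>x\<in>carrier G. \<forall>y\<in>carrier G. x \<otimes>\<^bsub>G\<^esub> inv\<^bsub>G\<^esub> y \<in> V \<longrightarrow> cmod (f x - f y) < e))}"

text \<open>Gelfand spectrum: nonzero multiplicative linear functionals on RUCB(G)
  (represented as functions extensional on RUCB(G)), with the weak-* topology,
  i.e. the topology of pointwise convergence on RUCB(G).\<close>
definition greatest_ambit :: "'g monoid \<Rightarrow> 'g topology \<Rightarrow> (('g \<Rightarrow> complex) \<Rightarrow> complex) set" where
  "greatest_ambit G T = {\<phi>. \<phi> \<in> extensional (RUCB G T) \<and>
      (\<forall>f\<in>RUCB G T. \<forall>g\<in>RUCB G T. \<phi> (\<lambda>x. f x + g x) = \<phi> f + \<phi> g) \<and>
      (\<forall>c. \<forall>f\<in>RUCB G T. \<phi> (\<lambda>x. c * f x) = c * \<phi> f) \<and>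
      (\<forall>f\<in>RUCB G T. \<forall>g\<in>RUCB G T. \<phi> (\<lambda>x. f x * g x) = \<phi> f * \<phi> g) \<and>
      (\<exists>f\<in>RUCB G T. \<phi> f \<noteq> 0)}"

definition greatest_ambit_top :: "'g monoid \<Rightarrow> 'g topology \<Rightarrow> (('g \<Rightarrow> complex) \<Rightarrow> complex) topology" where
  "greatest_ambit_top G T =
     subtopology (product_topology (\<lambda>_. euclidean) (RUCB G T)) (greatest_ambit G T)"

definition left_transl :: "'g monoid \<Rightarrow> 'g \<Rightarrow> ('g \<Rightarrow> complex) \<Rightarrow> ('g \<Rightarrow> complex)" where
  "left_transl G g x = (\<lambda>h. if h \<in> carrier G then x (inv\<^bsub>G\<^esub> g \<otimes>\<^bsub>G\<^esub> h) else 0)"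

definition greatest_ambit_act :: "'g monoid \<Rightarrow> 'g topology \<Rightarrow> 'g \<Rightarrow>
    (('g \<Rightarrow> complex) \<Rightarrow> complex) \<Rightarrow> (('g \<Rightarrow> complex) \<Rightarrow> complex)" where
  "greatest_ambit_act G T g \<phi> =
     restrict (\<lambda>x. \<phi> (left_transl G (inv\<^bsub>G\<^esub> g) x)) (RUCB G T)"

definition G_space :: "'g monoid \<Rightarrow> 'g topology \<Rightarrow> 'a topology \<Rightarrow> ('g \<Rightarrow> 'a \<Rightarrow> 'a) \<Rightarrow> bool" where
  "G_space G T X act \<longleftrightarrow>
     (\<forall>g\<in>carrier G. \<forall>x\<in>topspace X. act g x \<in> topspace X) \<and>
     (\<forall>x\<in>topspace X. act \<one>\<^bsub>G\<^esub> x = x) \<and>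
     (\<forall>g\<in>carrier G. \<forall>h\<in>carrier G. \<forall>x\<in>topspace X.
        act (g \<otimes>\<^bsub>G\<^esub> h) x = act g (act h x)) \<and>
     continuous_map (prod_topology T X) X (\<lambda>(g, x). act g x)"

definition equivariant :: "'g monoid \<Rightarrow> 'a topology \<Rightarrow> ('g \<Rightarrow> 'a \<Rightarrow> 'a) \<Rightarrow>
    ('g \<Rightarrow> 'b \<Rightarrow> 'b) \<Rightarrow> ('a \<Rightarrow> 'b) \<Rightarrow> bool" where
  "equivariant G X actX actY f \<longleftrightarrow>
     (\<forall>g\<in>carrier G. \<forall>x\<in>topspace X. f (actX g x) = actY g (f x))"

definition G_isomorphism :: "'g monoid \<Rightarrow> 'a topology \<Rightarrow> ('g \<Rightarrow> 'a \<Rightarrow> 'a) \<Rightarrow>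
    'b topology \<Rightarrow> ('g \<Rightarrow> 'b \<Rightarrow> 'b) \<Rightarrow> ('a \<Rightarrow> 'b) \<Rightarrow> bool" where
  "G_isomorphism G X actX Y actY f \<longleftrightarrow>
     homeomorphic_map X Y f \<and> equivariant G X actX actY f"

definition covering_dim_zero :: "'a topology \<Rightarrow> bool" where
  "covering_dim_zero X \<longleftrightarrow> topspace X \<noteq> {} \<and>
     (\<forall>\<U>. finite \<U> \<and> (\<forall>U\<in>\<U>. openin X U) \<and> \<Union>\<U> = topspace X \<longrightarrow>
        (\<exists>\<V>. finite \<V> \<and> (\<forall>V\<in>\<V>. openin X V) \<and> \<Union>\<V> = topspace X \<and>
             pairwise disjnt \<V> \<and> (\<forall>V\<in>\<V>. \<exists>U\<in>\<U>. V \<subseteq> U)))"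

definition directed_set :: "'i set \<Rightarrow> ('i \<Rightarrow> 'i \<Rightarrow> bool) \<Rightarrow> bool" where
  "directed_set I leq \<longleftrightarrow> I \<noteq> {} \<and> (\<forall>i\<in>I. leq i i) \<and>
     (\<forall>i\<in>I. \<forall>j\<in>I. \<forall>k\<in>I. leq i j \<and> leq j k \<longrightarrow> leq i k) \<and>
     (\<forall>i\<in>I. \<forall>j\<in>I. \<exists>k\<in>I. leq i k \<and> leq j k)"

definition G_inverse_system :: "'g monoid \<Rightarrow> 'g topology \<Rightarrow> 'i set \<Rightarrow> ('i \<Rightarrow> 'i \<Rightarrow> bool) \<Rightarrow>
    ('i \<Rightarrow> 'a topology) \<Rightarrow> ('i \<Rightarrow> 'g \<Rightarrow> 'a \<Rightarrow> 'a) \<Rightarrow> ('i \<Rightarrow> 'i \<Rightarrow> 'a \<Rightarrow> 'a) \<Rightarrow> bool" where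
  "G_inverse_system G T I leq X act p \<longleftrightarrow>
     directed_set I leq \<and>
     (\<forall>i\<in>I. G_space G T (X i) (act i)) \<and>
     (\<forall>i\<in>I. \<forall>j\<in>I. leq i j \<longrightarrow>
        continuous_map (X j) (X i) (p j i) \<and> equivariant G (X j) (act j) (act i) (p j i)) \<and>
     (\<forall>i\<in>I. \<forall>x\<in>topspace (X i). p i i x = x) \<and>
     (\<forall>i\<in>I. \<forall>j\<in>I. \<forall>k\<in>I. leq i j \<and> leq j k \<longrightarrow>
        (\<forall>x\<in>topspace (X k). p k i x = p j i (p k j x)))"

definition inv_limit_top :: "'i set \<Rightarrow> ('i \<Rightarrow> 'i \<Rightarrow> bool) \<Rightarrow> ('i \<Rightarrow> 'a topology) \<Rightarrow>
    ('i \<Rightarrow> 'i \<Rightarrow> 'a \<Rightarrow> 'a) \<Rightarrow> ('i \<Rightarrow> 'a) topology" where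
  "inv_limit_top I leq X p = subtopology (product_topology X I)
     {x \<in> topspace (product_topology X I). \<forall>i\<in>I. \<forall>j\<in>I. leq i j \<longrightarrow> p j i (x j) = x i}"

definition inv_limit_act :: "'i set \<Rightarrow> ('i \<Rightarrow> 'g \<Rightarrow> 'a \<Rightarrow> 'a) \<Rightarrow> 'g \<Rightarrow> ('i \<Rightarrow> 'a) \<Rightarrow> ('i \<Rightarrow> 'a)" where
  "inv_limit_act I act g x = restrict (\<lambda>i. act i g (x i)) I"

definition Cantor_space :: "(nat \<Rightarrow> bool) topology" where
  "Cantor_space = product_topology (\<lambda>_. discrete_topology UNIV) UNIV"

end

theory Submission
  imports Defs
begin

text \<open>
  An idempotent of \<open>RUCB(G)\<close> is invariant under left multiplication by a neighbourhood of the
  identity, so by separability its \<open>G\<close>-orbit is countable. Restricting the characters in \<open>S(G)\<close>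
  to the orbits of a finite set \<open>E\<close> of idempotents therefore gives a metrizable zero-dimensional
  quotient \<open>G\<close>-space of \<open>S(G)\<close>. As \<open>G\<close> is non-archimedean, step functions on the right cosets of
  open subgroups are dense in \<open>RUCB(G)\<close>, hence idempotents separate the points of the compact space
  \<open>S(G)\<close>, which is thus the inverse limit of these quotients.

  The quotients may have isolated points (for discrete \<open>G\<close> and large \<open>E\<close> they do). This is repaired
  by taking the product with a Cantor set on which \<open>G\<close> acts trivially and collapsing that factor to
  a point under every bonding map between distinct indices. A compact space embeddable in the Cantor
  set becomes homeomorphic to the Cantor set after this product.
\<close>

section \<open>The Cantor space\<close>

text \<open>The indices are finite subsets of all of \<open>RUCB G T\<close>, although only the
  idempotents in them shape the quotient. The set of idempotents can be finite, for instance when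
  \<open>G\<close> is finite; its finite subsets would then have a largest member, and the Cantor
  factor at that index would survive in the limit. The constant functions already make
  \<open>RUCB G T\<close> infinite, so every index lies properly below another one, and the Cantor
  coordinates of a thread are forced to the collapsed value. The price is that the maps from the
  ambit to the thickened spaces are not surjective. Surjectivity onto the limit is recovered from
  the images of bonding maps out of larger indices. Whole orbits are kept, and not just the members
  of \<open>E\<close>, so that restriction of characters is equivariant. Joint continuity of the
  action then rests on the fact that the translate of an idempotent depends locally constantly on
  the group element.\<close>

lemma locally_constant_imp_continuous_map:
  assumes "\<And>x. x \<in> topspace X \<Longrightarrow> f x \<in> topspace Y"
    and "\<And>x. x \<in> topspace X \<Longrightarrow> \<exists>U. openin X U \<and> x \<in> U \<and> (\<forall>y\<in>U. f y = f x)"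
  shows "continuous_map X Y f"
  unfolding continuous_map
proof (intro conjI allI impI)
  show "f ` topspace X \<subseteq> topspace Y" using assms(1) by blast
  fix V assume "openin Y V"
  show "openin X {x \<in> topspace X. f x \<in> V}"
  proof (subst openin_subopen, clarify)
    fix x assume x: "x \<in> topspace X" "f x \<in> V"
    obtain U where "openin X U" "x \<in> U" "\<forall>y\<in>U. f y = f x" using assms(2)[OF x(1)] by blast
    then show "\<exists>U. openin X U \<and> x \<in> U \<and> U \<subseteq> {x \<in> topspace X. f x \<in> V}"
      using x(2) openin_subset by (intro exI[of _ U]) fastforce
  qed
qed

lemma topspace_Cantor_space [simp]: "topspace Cantor_space = UNIV"
  by (simp add: Cantor_space_def)

lemma Hausdorff_Cantor_space: "Hausdorff_space Cantor_space"
  by (simp add: Cantor_space_def Hausdorff_space_product_topology)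

lemma compact_Cantor_space: "compact_space Cantor_space"
  by (simp add: Cantor_space_def compact_space_product_topology compact_space_discrete_topology)

lemma metrizable_Cantor_space: "metrizable_space Cantor_space"
  by (simp add: Cantor_space_def metrizable_space_product_topology metrizable_space_discrete_topology)

lemma continuous_map_Cantor_space:
  "continuous_map X Cantor_space f \<longleftrightarrow> (\<forall>n. continuous_map X (discrete_topology UNIV) (\<lambda>x. f x n))"
  by (simp add: Cantor_space_def continuous_map_componentwise_UNIV)

section \<open>Recognising the Cantor space by the branching of an embedding into it\<close>

lemma openin_agreement_set:
  assumes "continuous_map X Cantor_space e"
  shows "openin X {x \<in> topspace X. \<forall>m<n. e x m = b m}"
proof (induction n)
  case (Suc n)
  have "continuous_map X (discrete_topology UNIV) (\<lambda>x. e x n)"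
    using assms by (simp add: continuous_map_Cantor_space)
  then have "openin X {x \<in> topspace X. e x n \<in> {b n}}"
    by (rule openin_continuous_map_preimage) simp
  from openin_Int[OF Suc this] show ?case
    by (rule back_subst[of "openin X"]) (auto simp: less_Suc_eq)
qed simp

text \<open>The k-th element is found by searching upwards, so the part of the set up to that
  element decides it. Hence a rule that reads the k-th branching bit looks at only finitely many
  bits of its argument, which makes it continuous.\<close>

lemma enumerate_eq_initial:
  fixes S S' :: "nat set"
  assumes "infinite S" "infinite S'" and eq: "S \<inter> {..n} = S' \<inter> {..n}"
  shows "enumerate S k \<le> n \<Longrightarrow> enumerate S' k = enumerate S k"
proof -
  have mem: "m \<in> S \<longleftrightarrow> m \<in> S'" if "m \<le> n" for m
    using that eq by (metis IntD1 IntI atMost_iff)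
  show "enumerate S k \<le> n \<Longrightarrow> enumerate S' k = enumerate S k"
  proof (induction k)
    case 0
    have "enumerate S 0 \<in> S" using assms(1) by (rule enumerate_in_set)
    then have "enumerate S 0 \<in> S'" using mem 0 by blast
    moreover have "enumerate S 0 \<le> s" if "s \<in> S'" for s
    proof (rule ccontr)
      assume "\<not> ?thesis"
      then have "s \<in> S" "s < enumerate S 0" using that mem[of s] 0 by linarith+
      moreover from this(1) have "enumerate S 0 \<le> s" unfolding enumerate_0 by (rule Least_le)
      ultimately show False by simp
    qed
    ultimately show ?case
      unfolding enumerate_0[of S'] by (intro Least_equality)
  next
    case (Suc k)
    have less: "enumerate S k < enumerate S (Suc k)" using assms(1) by (rule enumerate_step)
    then have IH: "enumerate S' k = enumerate S k" using Suc by simp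
    have "enumerate S (Suc k) \<in> S" using assms(1) by (rule enumerate_in_set)
    then have "enumerate S (Suc k) \<in> S'" using mem Suc.prems by blast
    moreover have "enumerate S (Suc k) \<le> s" if "s \<in> S'" "enumerate S k < s" for s
    proof (rule ccontr)
      assume "\<not> ?thesis"
      then have "s \<in> S \<and> enumerate S k < s" "s < enumerate S (Suc k)"
        using that mem[of s] Suc.prems by linarith+
      moreover from this(1) have "enumerate S (Suc k) \<le> s"
        unfolding enumerate_Suc''[OF assms(1)] by (rule Least_le)
      ultimately show False by simp
    qed
    ultimately show ?case
      unfolding enumerate_Suc''[OF assms(2)] IH using less by (intro Least_equality) auto
  qed
qed

text \<open>Reading off only those bits of \<open>e w\<close> at which the image of \<open>e\<close> branches turns the
  embedding \<open>e\<close> into a bijection onto the full Cantor space.\<close>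

proposition homeomorphic_Cantor_space_if_branching:
  assumes comp: "compact_space X" and ne: "topspace X \<noteq> {}"
    and cont: "continuous_map X Cantor_space e" and inj: "inj_on e (topspace X)"
    and branching: "\<And>w. w \<in> topspace X \<Longrightarrow>
      infinite {n. \<exists>w'\<in>topspace X. (\<forall>m<n. e w' m = e w m) \<and> e w' n \<noteq> e w n}"
  shows "X homeomorphic_space Cantor_space"
proof -
  define W where "W = topspace X"
  \<comment> \<open>View the image of \<open>e\<close> as the set of branches of a binary tree:
    \<open>S w\<close> lists the levels at which the branch \<open>e w\<close> passes a splitting
    node.\<close>
  define S where "S w = {n. \<exists>w'\<in>W. (\<forall>m<n. e w' m = e w m) \<and> e w' n \<noteq> e w n}" for w
  define h where "h w k = e w (enumerate (S w) k)" for w k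
  have inf: "infinite (S w)" if "w \<in> W" for w
    using branching that by (simp add: S_def W_def)
  have S_sub: "S w \<inter> {..n} \<subseteq> S w'"
    if "w \<in> W" "w' \<in> W" and agree: "\<forall>m<n. e w' m = e w m" for w w' n
  proof
    fix m assume "m \<in> S w \<inter> {..n}"
    then obtain v where v: "v \<in> W" "\<forall>i<m. e v i = e w i" "e v m \<noteq> e w m" and "m \<le> n"
      by (auto simp: S_def)
    have "\<forall>i<m. e v i = e w' i" "\<forall>i<m. e w i = e w' i" using v \<open>m \<le> n\<close> agree by auto
    \<comment> \<open>Agreement is assumed strictly below \<open>n\<close>, yet level
      \<open>n\<close> itself is covered: if \<open>w'\<close> follows \<open>w\<close> at
      \<open>m\<close>, then \<open>v\<close> splits off from \<open>w'\<close>; otherwise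
      \<open>m = n\<close> and \<open>w\<close> itself does.\<close>
    then show "m \<in> S w'"
      using v that(1) unfolding S_def by (cases "e w' m = e w m") auto
  qed
  have S_eq: "S w \<inter> {..n} = S w' \<inter> {..n}"
    if "w \<in> W" "w' \<in> W" "\<forall>m<n. e w' m = e w m" for w w' n
    using S_sub[of w w' n] S_sub[of w' w n] that by fastforce
  have enum_eq: "enumerate (S w') k = enumerate (S w) k"
    if "w \<in> W" "w' \<in> W" "\<forall>m<n. e w' m = e w m" "enumerate (S w) k \<le> n" for w w' n k
    using enumerate_eq_initial[OF inf inf S_eq] that by blast
  have "continuous_map X (discrete_topology UNIV) (\<lambda>w. h w k)" for k
  proof (rule locally_constant_imp_continuous_map)
    fix w assume w: "w \<in> topspace X"
    let ?n = "enumerate (S w) k"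
    \<comment> \<open>Agreement below \<open>?n\<close> fixes the position that is read; the
      \<open>Suc\<close> adds agreement at \<open>?n\<close>, the bit found there.\<close>
    let ?U = "{w' \<in> topspace X. \<forall>m<Suc ?n. e w' m = e w m}"
    have "h w' k = h w k" if "w' \<in> ?U" for w'
      using that w enum_eq[of w w' ?n k] by (simp add: h_def W_def)
    then show "\<exists>U. openin X U \<and> w \<in> U \<and> (\<forall>w'\<in>U. h w' k = h w k)"
      using openin_agreement_set[OF cont, of "Suc ?n" "e w"] w by (intro exI[of _ ?U]) blast
  qed simp
  then have h_cont: "continuous_map X Cantor_space h"
    by (simp add: continuous_map_Cantor_space)
  have "inj_on h (topspace X)"
  proof (rule inj_onI, rule ccontr)
    fix w w' assume w: "w \<in> topspace X" "w' \<in> topspace X" "h w = h w'" "w \<noteq> w'"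
    \<comment> \<open>The first level at which two branches differ is a splitting level of both and
      has the same index in both enumerations, so \<open>h\<close> reads it and sees the
      difference.\<close>
    then have "e w' \<noteq> e w" using inj by (auto dest: inj_onD)
    then have "\<exists>n. e w' n \<noteq> e w n" by (simp add: fun_eq_iff)
    then obtain n where n: "e w' n \<noteq> e w n" "\<forall>m<n. e w' m = e w m"
      using exists_least_iff[of "\<lambda>n. e w' n \<noteq> e w n"] by auto
    then have "n \<in> S w" using w unfolding S_def W_def by auto
    then obtain k where k: "enumerate (S w) k = n"
      using enumerate_Ex inf w(1) W_def by metis
    then have "enumerate (S w') k = n"
      using enum_eq[of w w' n k] w n by (simp add: W_def)
    then show False using k n w(3) by (metis h_def)
  qed
  moreover have "b \<in> h ` topspace X" for b
  proof -
    \<comment> \<open>By compactness it is enough to realise each finite initial segment of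
      \<open>b\<close>.\<close>
    define C where "C k = {w \<in> topspace X. \<forall>i<k. h w i = b i}" for k
    have "closedin X (C k)" for k
    proof -
      have "C k = {w \<in> topspace X. h w \<in> {c. \<forall>i<k. c i = b i}}" by (simp add: C_def)
      moreover have "closedin Cantor_space {c. \<forall>i<k. c i = b i}"
      proof -
        have "{c. \<forall>i<k. c i = b i} = Pi\<^sub>E UNIV (\<lambda>i. if i < k then {b i} else UNIV)"
          by (auto simp: PiE_iff split: if_splits)
        then show ?thesis
          unfolding Cantor_space_def by (simp add: closedin_product_topology)
      qed
      ultimately show ?thesis
        using closedin_continuous_map_preimage[OF h_cont, of "{c. \<forall>i<k. c i = b i}"] by simp
    qed
    moreover have "C k \<noteq> {}" for k
    proof (induction k)
      case 0
      then show ?case using ne by (auto simp: C_def)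
    next
      case (Suc k)
      then obtain w where w: "w \<in> W" "\<forall>i<k. h w i = b i" by (auto simp: C_def W_def)
      let ?n = "enumerate (S w) k"
      show ?case
      proof (cases "h w k = b k")
        case True
        then show ?thesis using w by (auto simp: C_def W_def less_Suc_eq)
      next
        case False
        \<comment> \<open>If the k-th bit read from \<open>w\<close> is wrong, move to a branch that
          leaves \<open>w\<close> exactly there. It keeps the first \<open>k\<close> splitting
          levels with their bits, as well as the position of the next one, and has the opposite bit
          at that position.\<close>
        have "?n \<in> S w" using inf w(1) by (blast intro: enumerate_in_set)
        then obtain v where v: "v \<in> W" "\<forall>m<?n. e v m = e w m" "e v ?n \<noteq> e w ?n"
          by (auto simp: S_def)
        have le: "enumerate (S w) i \<le> ?n" if "i \<le> k" for i
          using that inf[OF w(1)] by simp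
        have ev: "enumerate (S v) i = enumerate (S w) i" if "i \<le> k" for i
          using enum_eq[OF w(1) v(1,2) le[OF that]] .
        have "h v i = b i" if "i < k" for i
        proof -
          have "enumerate (S w) i < ?n" using that inf[OF w(1)] by (simp add: enumerate_mono)
          then show ?thesis using ev[of i] that v(2) w(2) by (simp add: h_def)
        qed
        moreover have "h v k = b k" using ev[of k] v(3) False by (simp add: h_def)
        ultimately show ?thesis using v(1) by (auto simp: C_def W_def less_Suc_eq)
      qed
    qed
    moreover have "decseq C" by (auto simp: decseq_def C_def)
    ultimately have "(\<Inter>k. C k) \<noteq> {}" using compact_space_imp_nest[OF comp] by blast
    then obtain w where "\<forall>k. w \<in> C k" by blast
    then have "w \<in> topspace X" "h w = b" by (auto simp: C_def)
    then show ?thesis by blast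
  qed
  ultimately have "homeomorphic_map X Cantor_space h"
    using h_cont comp Hausdorff_Cantor_space
    by (intro continuous_imp_homeomorphic_map) auto
  then show ?thesis using homeomorphic_map_imp_homeomorphic_space by blast
qed

text \<open>Interleave the bits of \<open>d\<close> (even positions) with those of the Cantor
  coordinate (odd positions). A single bit of the Cantor coordinate can be flipped freely, and this
  changes only one odd position, so every odd position is a branching level of every point.\<close>

corollary prod_Cantor_space_homeomorphic:
  assumes comp: "compact_space Z" and ne: "topspace Z \<noteq> {}"
    and cont: "continuous_map Z Cantor_space d" and inj: "inj_on d (topspace Z)"
  shows "prod_topology Z Cantor_space homeomorphic_space Cantor_space"
proof (rule homeomorphic_Cantor_space_if_branching)
  define e :: "'a \<times> (nat \<Rightarrow> bool) \<Rightarrow> nat \<Rightarrow> bool"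
    where "e w n = (if even n then d (fst w) (n div 2) else snd w (n div 2))" for w n
  let ?X = "prod_topology Z Cantor_space"
  show "compact_space ?X"
    using comp compact_Cantor_space by (simp add: compact_space_prod_topology)
  show "topspace ?X \<noteq> {}" using ne by simp
  have d_fst: "continuous_map ?X Cantor_space (d \<circ> fst)"
    using cont continuous_map_compose continuous_map_fst by blast
  have "continuous_map ?X (discrete_topology UNIV) (\<lambda>w. e w n)" for n
  proof (cases "even n")
    case True
    then show ?thesis
      using d_fst by (simp add: e_def continuous_map_Cantor_space)
  next
    case False
    have "continuous_map ?X Cantor_space snd" by (rule continuous_map_snd)
    with False show ?thesis
      by (simp add: e_def continuous_map_Cantor_space)
  qed
  then show "continuous_map ?X Cantor_space e"
    by (simp add: continuous_map_Cantor_space)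
  show "inj_on e (topspace ?X)"
  proof (rule inj_onI)
    fix w w' assume w: "w \<in> topspace ?X" "w' \<in> topspace ?X" "e w = e w'"
    have "d (fst w) n = d (fst w') n" for n
      using fun_cong[OF w(3), of "2 * n"] by (simp add: e_def)
    then have "d (fst w) = d (fst w')" by (rule ext)
    then have "fst w = fst w'" using w(1,2) inj by (auto dest: inj_onD)
    moreover have "snd w n = snd w' n" for n
      using fun_cong[OF w(3), of "Suc (2 * n)"] by (simp add: e_def)
    ultimately show "w = w'" by (simp add: prod_eq_iff fun_eq_iff)
  qed
  fix w assume w: "w \<in> topspace ?X"
  let ?S = "{n. \<exists>w'\<in>topspace ?X. (\<forall>m<n. e w' m = e w m) \<and> e w' n \<noteq> e w n}"
  have "Suc (2 * k) \<in> ?S" for k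
  proof -
    let ?w' = "(fst w, (snd w)(k := \<not> snd w k))"
    have "e ?w' m = e w m" if "m < Suc (2 * k)" for m
    proof -
      have "odd m \<Longrightarrow> m div 2 \<noteq> k" using that by presburger
      then show ?thesis by (simp add: e_def)
    qed
    moreover have "e ?w' (Suc (2 * k)) \<noteq> e w (Suc (2 * k))" by (simp add: e_def)
    moreover have "?w' \<in> topspace ?X" using w by auto
    ultimately show ?thesis by blast
  qed
  then have "range (\<lambda>k. Suc (2 * k)) \<subseteq> ?S" by blast
  moreover have "infinite (range (\<lambda>k::nat. Suc (2 * k)))"
    by (intro range_inj_infinite) (simp add: inj_def)
  ultimately show "infinite ?S" using finite_subset by blast
qed

text \<open>Cylinders of one fixed length are equal or disjoint. Compactness supplies a length
  \<open>M\<close>, playing the role of a Lebesgue number, for which each cylinder fits into a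
  member of the cover.\<close>

lemma covering_dim_zero_Cantor_space: "covering_dim_zero Cantor_space"
  unfolding covering_dim_zero_def
proof (intro conjI allI impI)
  fix \<U> :: "(nat \<Rightarrow> bool) set set"
  assume \<U>: "finite \<U> \<and> (\<forall>U\<in>\<U>. openin Cantor_space U) \<and> \<Union>\<U> = topspace Cantor_space"
  define cyl where "cyl n c = {c' :: nat \<Rightarrow> bool. \<forall>m<n. c' m = c m}" for n c
  have cyl_open: "openin Cantor_space (cyl n c)" for n c
    using openin_agreement_set[of Cantor_space id n c] by (simp add: cyl_def)
  have "\<exists>n. \<exists>U\<in>\<U>. cyl n c \<subseteq> U" for c
  proof -
    have "c \<in> \<Union>\<U>" using \<U> by simp
    then obtain U where U: "U \<in> \<U>" "c \<in> U" "openin Cantor_space U" using \<U> by blast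
    then obtain V where V: "finite {i. V i \<noteq> UNIV}" "c \<in> Pi\<^sub>E UNIV V" "Pi\<^sub>E UNIV V \<subseteq> U"
      unfolding Cantor_space_def openin_product_topology_alt by auto
    obtain n where n: "\<And>i. V i \<noteq> UNIV \<Longrightarrow> i < n"
      using V(1) by (metis (mono_tags) finite_nat_set_iff_bounded mem_Collect_eq)
    have "cyl n c \<subseteq> Pi\<^sub>E UNIV V"
    proof
      fix x assume "x \<in> cyl n c"
      have "x i \<in> V i" for i
      proof (cases "V i = UNIV")
        case False
        then have "x i = c i" using n \<open>x \<in> cyl n c\<close> by (simp add: cyl_def)
        then show ?thesis using V(2) by (simp add: PiE_iff)
      qed simp
      then show "x \<in> Pi\<^sub>E UNIV V" by (simp add: PiE_iff)
    qed
    then have "cyl n c \<subseteq> U" using V(3) by (rule subset_trans)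
    then show ?thesis using U(1) by (intro exI bexI)
  qed
  then obtain N where N: "\<And>c. \<exists>U\<in>\<U>. cyl (N c) c \<subseteq> U" by metis
  obtain \<F> where \<F>: "finite \<F>" "\<F> \<subseteq> range (\<lambda>c. cyl (N c) c)"
      "topspace Cantor_space \<subseteq> \<Union>\<F>"
  proof (rule compactinD[of Cantor_space "topspace Cantor_space" "range (\<lambda>c. cyl (N c) c)", THEN exE])
    show "compactin Cantor_space (topspace Cantor_space)"
      using compact_Cantor_space by (simp add: compact_space_def)
    show "topspace Cantor_space \<subseteq> \<Union>(range (\<lambda>c. cyl (N c) c))"
      by (auto simp: cyl_def)
  qed (use cyl_open in auto)
  then obtain A where "finite A" "\<F> = (\<lambda>c. cyl (N c) c) ` A"
    using finite_subset_image[OF \<F>(1,2)] by metis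
  then have A: "finite A" "UNIV = (\<Union>c\<in>A. cyl (N c) c)" using \<F>(3) by auto
  define M where "M = Max (N ` A)"
  have M: "\<exists>U\<in>\<U>. cyl M c \<subseteq> U" for c
  proof -
    obtain a where a: "a \<in> A" "c \<in> cyl (N a) a" using A(2) by blast
    have "N a \<le> M" using a A(1) by (simp add: M_def)
    then have "cyl M c \<subseteq> cyl (N a) a" using a(2) by (auto simp: cyl_def)
    then show ?thesis using N[of a] by blast
  qed
  show "\<exists>\<V>. finite \<V> \<and> (\<forall>V\<in>\<V>. openin Cantor_space V) \<and> \<Union>\<V> = topspace Cantor_space \<and>
             pairwise disjnt \<V> \<and> (\<forall>V\<in>\<V>. \<exists>U\<in>\<U>. V \<subseteq> U)"
  proof (intro exI conjI)
    \<comment> \<open>Only the bits below \<open>M\<close> matter, so the set of positions below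
      \<open>M\<close> that carry \<open>True\<close> names the cylinder; there are finitely many
      such sets.\<close>
    have "cyl M c \<in> (\<lambda>B. cyl M (\<lambda>m. m \<in> B)) ` Pow {..<M}" for c
      by (rule image_eqI[of _ _ "{m. m < M \<and> c m}"]) (auto simp: cyl_def)
    then have "range (cyl M) \<subseteq> (\<lambda>B. cyl M (\<lambda>m. m \<in> B)) ` Pow {..<M}"
      by blast
    then show "finite (range (cyl M))"
      by (rule finite_subset) simp
    show "\<Union>(range (cyl M)) = topspace Cantor_space" by (auto simp: cyl_def)
    show "pairwise disjnt (range (cyl M))"
      by (auto simp: pairwise_def disjnt_def cyl_def)
    show "\<forall>V\<in>range (cyl M). openin Cantor_space V" using cyl_open by blast
    show "\<forall>V\<in>range (cyl M). \<exists>U\<in>\<U>. V \<subseteq> U" using M by blast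
  qed
qed simp

lemma covering_dim_zero_homeomorphic:
  assumes "X homeomorphic_space Y" and Y: "covering_dim_zero Y"
  shows "covering_dim_zero X"
proof -
  obtain f g where f: "continuous_map X Y f" and g: "continuous_map Y X g"
    and gf: "\<And>x. x \<in> topspace X \<Longrightarrow> g (f x) = x"
    using assms(1) by (auto simp: homeomorphic_space_def homeomorphic_maps_def)
  show ?thesis unfolding covering_dim_zero_def
  proof (intro conjI allI impI)
    show "topspace X \<noteq> {}"
      using Y continuous_map_image_subset_topspace[OF g]
      by (auto simp: covering_dim_zero_def)
    fix \<U> assume \<U>: "finite \<U> \<and> (\<forall>U\<in>\<U>. openin X U) \<and> \<Union>\<U> = topspace X"
    define pre where "pre U = {y \<in> topspace Y. g y \<in> U}" for U
    have "\<Union>(pre ` \<U>) = {y \<in> topspace Y. g y \<in> \<Union>\<U>}" by (auto simp: pre_def)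
    also have "\<dots> = topspace Y"
      using \<U> continuous_map_image_subset_topspace[OF g] by auto
    finally have "\<Union>(pre ` \<U>) = topspace Y" .
    moreover have "\<forall>U\<in>pre ` \<U>. openin Y U"
      using \<U> g by (auto simp: pre_def openin_continuous_map_preimage)
    moreover have "finite (pre ` \<U>)" using \<U> by simp
    ultimately have "\<exists>\<V>. finite \<V> \<and> (\<forall>V\<in>\<V>. openin Y V) \<and> \<Union>\<V> = topspace Y \<and>
        pairwise disjnt \<V> \<and> (\<forall>V\<in>\<V>. \<exists>U\<in>pre ` \<U>. V \<subseteq> U)"
      using Y[unfolded covering_dim_zero_def, THEN conjunct2, THEN spec, of "pre ` \<U>"] by simp
    then obtain \<V> where \<V>: "finite \<V>" "\<forall>V\<in>\<V>. openin Y V" "\<Union>\<V> = topspace Y"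
      "pairwise disjnt \<V>" "\<forall>V\<in>\<V>. \<exists>U\<in>pre ` \<U>. V \<subseteq> U"
      by (elim exE conjE)
    define q where "q V = {x \<in> topspace X. f x \<in> V}" for V
    show "\<exists>\<V>. finite \<V> \<and> (\<forall>V\<in>\<V>. openin X V) \<and> \<Union>\<V> = topspace X \<and>
             pairwise disjnt \<V> \<and> (\<forall>V\<in>\<V>. \<exists>U\<in>\<U>. V \<subseteq> U)"
    proof (intro exI conjI)
      show "finite (q ` \<V>)" using \<V>(1) by simp
      show "\<forall>V\<in>q ` \<V>. openin X V"
        using \<V>(2) f by (auto simp: q_def openin_continuous_map_preimage)
      have "\<Union>(q ` \<V>) = {x \<in> topspace X. f x \<in> \<Union>\<V>}" by (auto simp: q_def)
      also have "\<dots> = topspace X"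
        using \<V>(3) continuous_map_image_subset_topspace[OF f] by auto
      finally show "\<Union>(q ` \<V>) = topspace X" .
      show "pairwise disjnt (q ` \<V>)"
        using \<V>(4) unfolding pairwise_def disjnt_def q_def by blast
      show "\<forall>V\<in>q ` \<V>. \<exists>U\<in>\<U>. V \<subseteq> U"
      proof clarify
        fix V assume "V \<in> \<V>"
        then obtain U where "U \<in> \<U>" "V \<subseteq> pre U" using \<V>(5) by blast
        moreover have "q V \<subseteq> U"
        proof
          fix x assume "x \<in> q V"
          then have "x \<in> topspace X" "f x \<in> V" by (auto simp: q_def)
          then show "x \<in> U" using \<open>V \<subseteq> pre U\<close> gf[of x] by (auto simp: pre_def)
        qed
        ultimately show "\<exists>U\<in>\<U>. q V \<subseteq> U" by blast
      qed
    qed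
  qed
qed

section \<open>Inverse limits of G-spaces\<close>

lemma directed_set_finite_upper_bound:
  assumes dir: "directed_set I leq" and "finite J" "J \<subseteq> I"
  shows "\<exists>k\<in>I. \<forall>i\<in>J. leq i k"
  using assms(2,3)
proof (induction J)
  case empty
  have "I \<noteq> {}" using dir by (simp add: directed_set_def)
  then show ?case by blast
next
  case (insert j J)
  then obtain k where k: "k \<in> I" "\<forall>i\<in>J. leq i k" by auto
  obtain l where l: "l \<in> I" "leq j l" "leq k l"
    using dir insert.prems k(1) unfolding directed_set_def by (metis insert_subset)
  have "leq i l" if "i \<in> J" for i
  proof -
    have "i \<in> I" "leq i k" using that k(2) insert.prems by auto
    then show ?thesis using dir k(1) l unfolding directed_set_def by metis
  qed
  then show ?case using l(1,2) by blast
qed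

text \<open>Only a bonding map out of some later index has to map into the image of \<open>\<pi> i\<close>; the maps
  \<open>\<pi> i\<close> themselves need not be surjective.\<close>

lemma G_isomorphism_inv_limit:
  assumes sys: "G_inverse_system G T I leq X act p"
    and comp: "compact_space S" and haus: "\<And>i. i \<in> I \<Longrightarrow> Hausdorff_space (X i)"
    and cont: "\<And>i. i \<in> I \<Longrightarrow> continuous_map S (X i) (\<pi> i)"
    and compat: "\<And>i j x. \<lbrakk>i \<in> I; j \<in> I; leq i j; x \<in> topspace S\<rbrakk> \<Longrightarrow> p j i (\<pi> j x) = \<pi> i x"
    and equi: "\<And>i. i \<in> I \<Longrightarrow> equivariant G S actS (act i) (\<pi> i)"
    and inj: "\<And>x y. \<lbrakk>x \<in> topspace S; y \<in> topspace S; \<And>i. i \<in> I \<Longrightarrow> \<pi> i x = \<pi> i y\<rbrakk> \<Longrightarrow> x = y"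
    and cofinal: "\<And>i. i \<in> I \<Longrightarrow> \<exists>j\<in>I. leq i j \<and> p j i ` topspace (X j) \<subseteq> \<pi> i ` topspace S"
  shows "G_isomorphism G S actS (inv_limit_top I leq X p) (inv_limit_act I act)
    (\<lambda>x. \<lambda>i\<in>I. \<pi> i x)"
proof -
  let ?P = "product_topology X I"
  let ?L = "{x \<in> topspace ?P. \<forall>i\<in>I. \<forall>j\<in>I. leq i j \<longrightarrow> p j i (x j) = x i}"
  let ?h = "\<lambda>x. \<lambda>i\<in>I. \<pi> i x"
  have dir: "directed_set I leq" using sys by (simp add: G_inverse_system_def)
  have h_cont: "continuous_map S ?P ?h"
    using cont by (auto simp: continuous_map_componentwise)
  have top_L: "topspace (inv_limit_top I leq X p) = ?L"
    unfolding inv_limit_top_def topspace_subtopology by blast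
  have h_L: "?h x \<in> ?L" if "x \<in> topspace S" for x
  proof -
    have "?h x \<in> topspace ?P"
      using continuous_map_image_subset_topspace[OF h_cont] that by blast
    then show ?thesis using compat that by simp
  qed
  have "homeomorphic_map S (inv_limit_top I leq X p) ?h"
  proof (rule continuous_imp_homeomorphic_map[OF _ comp])
    show "continuous_map S (inv_limit_top I leq X p) ?h"
      unfolding inv_limit_top_def continuous_map_in_subtopology using h_cont h_L by blast
    show "Hausdorff_space (inv_limit_top I leq X p)"
      unfolding inv_limit_top_def
      using haus by (simp add: Hausdorff_space_subtopology Hausdorff_space_product_topology)
    show "inj_on ?h (topspace S)"
    proof (rule inj_onI)
      fix x y assume xy: "x \<in> topspace S" "y \<in> topspace S" "?h x = ?h y"
      have "\<pi> i x = \<pi> i y" if "i \<in> I" for i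
        using fun_cong[OF xy(3), of i] that by simp
      then show "x = y" using inj xy(1,2) by blast
    qed
    have "y \<in> ?h ` topspace S" if y: "y \<in> ?L" for y
    proof -
      have yX: "y i \<in> topspace (X i)" if "i \<in> I" for i
        using y that by (auto simp: PiE_iff)
      \<comment> \<open>The thread \<open>y\<close> is hit exactly when these fibres have a common
        point. They are closed and shrink along \<open>leq\<close>, so compactness and directedness
        reduce the question to each single fibre.\<close>
      define C where "C i = {x \<in> topspace S. \<pi> i x = y i}" for i
      have C_closed: "closedin S (C i)" if "i \<in> I" for i
      proof -
        have "closedin (X i) {y i}"
          using haus[OF that] yX[OF that] by (simp add: closedin_Hausdorff_singleton)
        from closedin_continuous_map_preimage[OF cont[OF that] this]
        show ?thesis by (simp add: C_def)
      qed
      \<comment> \<open>A thread has \<open>y i = p j i (y j)\<close> for every later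
        \<open>j\<close>; choosing \<open>j\<close> by \<open>cofinal\<close> places
        \<open>y i\<close> in the image of \<open>\<pi> i\<close>.\<close>
      have C_ne: "C i \<noteq> {}" if i: "i \<in> I" for i
      proof -
        obtain j where j: "j \<in> I" "leq i j" "p j i ` topspace (X j) \<subseteq> \<pi> i ` topspace S"
          using cofinal[OF i] by blast
        have "y i = p j i (y j)" using y i j by auto
        then have "y i \<in> \<pi> i ` topspace S" using j(3) yX[OF j(1)] by blast
        then show ?thesis by (auto simp: C_def)
      qed
      have C_mono: "C k \<subseteq> C i" if "i \<in> I" "k \<in> I" "leq i k" for i k
      proof
        fix x assume x: "x \<in> C k"
        have "\<pi> i x = p k i (y k)" using compat[OF that, of x] x by (simp add: C_def)
        also have "\<dots> = y i" using y that by blast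
        finally show "x \<in> C i" using x by (simp add: C_def)
      qed
      have "\<Inter>(C ` I) \<noteq> {}"
      proof -
        have fip: "\<Inter>\<F> \<noteq> {}" if F: "finite \<F>" "\<F> \<subseteq> C ` I" for \<F>
        proof -
          obtain J where J: "J \<subseteq> I" "finite J" "\<F> = C ` J"
            using finite_subset_image[OF F] by metis
          obtain k where k: "k \<in> I" "\<forall>i\<in>J. leq i k"
            using directed_set_finite_upper_bound[OF dir J(2,1)] by blast
          have "C k \<subseteq> \<Inter>\<F>" using C_mono k J by blast
          then show ?thesis using C_ne[OF k(1)] by blast
        qed
        have "\<forall>D\<in>C ` I. closedin S D" using C_closed by blast
        then show ?thesis
          using comp fip unfolding compact_space_fip by blast
      qed
      then obtain x where x: "\<And>i. i \<in> I \<Longrightarrow> x \<in> C i" by blast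
      have "I \<noteq> {}" using dir by (simp add: directed_set_def)
      then have "x \<in> topspace S" using x by (auto simp: C_def)
      moreover have "?h x = y"
      proof
        fix i show "?h x i = y i"
          using x[of i] y by (cases "i \<in> I") (auto simp: C_def PiE_iff extensional_def)
      qed
      ultimately show ?thesis by blast
    qed
    then show "?h ` topspace S = topspace (inv_limit_top I leq X p)"
      unfolding top_L using h_L by blast
  qed
  moreover have "equivariant G S actS (inv_limit_act I act) ?h"
    using equi by (auto simp: equivariant_def inv_limit_act_def fun_eq_iff restrict_def)
  ultimately show ?thesis by (simp add: G_isomorphism_def)
qed

section \<open>Transport of G-spaces and inverse systems along homeomorphisms\<close>

lemma G_space_transport:
  assumes Y: "G_space G T Y a" and uv: "homeomorphic_maps Y X u v"
  shows "G_space G T X (\<lambda>g x. u (a g (v x)))"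
proof -
  have u: "continuous_map Y X u" and v: "continuous_map X Y v"
    and vu: "\<And>y. y \<in> topspace Y \<Longrightarrow> v (u y) = y" and uv': "\<And>x. x \<in> topspace X \<Longrightarrow> u (v x) = x"
    using uv by (auto simp: homeomorphic_maps_def)
  have u_in: "u y \<in> topspace X" if "y \<in> topspace Y" for y
    using u that by (auto simp: continuous_map_def)
  have v_in: "v x \<in> topspace Y" if "x \<in> topspace X" for x
    using v that by (auto simp: continuous_map_def)
  have "continuous_map (prod_topology T X) (prod_topology T Y) (\<lambda>z. (fst z, v (snd z)))"
    by (intro continuous_map_pairedI continuous_map_fst
        continuous_map_compose[OF continuous_map_snd v, unfolded o_def])
  moreover have "continuous_map (prod_topology T Y) Y (\<lambda>(g, y). a g y)"
    using Y by (simp add: G_space_def)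
  ultimately have "continuous_map (prod_topology T X) X
      (u \<circ> ((\<lambda>(g, y). a g y) \<circ> (\<lambda>z. (fst z, v (snd z)))))"
    using u by (blast intro: continuous_map_compose)
  then have "continuous_map (prod_topology T X) X (\<lambda>(g, x). u (a g (v x)))"
    by (simp add: o_def case_prod_unfold)
  then show ?thesis
    using Y u_in v_in vu uv' unfolding G_space_def by simp
qed

lemma G_inverse_system_transport:
  assumes sys: "G_inverse_system G T I leq Y a q"
    and uv: "\<And>i. i \<in> I \<Longrightarrow> homeomorphic_maps (Y i) (X i) (u i) (v i)"
  shows "G_inverse_system G T I leq X (\<lambda>i g x. u i (a i g (v i x))) (\<lambda>j i x. u i (q j i (v j x)))"
proof -
  have u: "continuous_map (Y i) (X i) (u i)" and v: "continuous_map (X i) (Y i) (v i)"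
    and vu: "\<And>y. y \<in> topspace (Y i) \<Longrightarrow> v i (u i y) = y"
    and uv': "\<And>x. x \<in> topspace (X i) \<Longrightarrow> u i (v i x) = x" if "i \<in> I" for i
    using uv[OF that] by (auto simp: homeomorphic_maps_def)
  have v_in: "v i x \<in> topspace (Y i)" if "i \<in> I" "x \<in> topspace (X i)" for x i
    using v that by (auto simp: continuous_map_def)
  have gs: "G_space G T (Y i) (a i)" if "i \<in> I" for i
    using sys that by (simp add: G_inverse_system_def)
  then have a_in: "a i g y \<in> topspace (Y i)" if "i \<in> I" "g \<in> carrier G" "y \<in> topspace (Y i)" for i g y
    using that by (simp add: G_space_def)
  have q: "continuous_map (Y j) (Y i) (q j i)" "equivariant G (Y j) (a j) (a i) (q j i)"
    if "i \<in> I" "j \<in> I" "leq i j" for i j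
    using sys that by (auto simp: G_inverse_system_def)
  have q_in: "q j i y \<in> topspace (Y i)" if "i \<in> I" "j \<in> I" "leq i j" "y \<in> topspace (Y j)" for i j y
    using q(1)[OF that(1-3)] that(4) by (auto simp: continuous_map_def)
  show ?thesis unfolding G_inverse_system_def
  proof (intro conjI ballI impI)
    show "directed_set I leq" using sys by (simp add: G_inverse_system_def)
    show "G_space G T (X i) (\<lambda>g x. u i (a i g (v i x)))" if "i \<in> I" for i
      using G_space_transport gs uv that by blast
  next
    fix i j assume ij: "i \<in> I" "j \<in> I" "leq i j"
    have "continuous_map (X j) (X i) (u i \<circ> (q j i \<circ> v j))"
      using u v q ij by (blast intro: continuous_map_compose)
    then show "continuous_map (X j) (X i) (\<lambda>x. u i (q j i (v j x)))"
      by (simp add: o_def)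
    show "equivariant G (X j) (\<lambda>g x. u j (a j g (v j x))) (\<lambda>g x. u i (a i g (v i x)))
        (\<lambda>x. u i (q j i (v j x)))"
      using q(2)[OF ij] ij by (simp add: equivariant_def vu v_in a_in q_in)
  next
    fix i x assume "i \<in> I" "x \<in> topspace (X i)"
    then show "u i (q i i (v i x)) = x"
      using sys by (simp add: G_inverse_system_def v_in uv')
  next
    fix i j k x assume ijk: "i \<in> I" "j \<in> I" "k \<in> I" "leq i j \<and> leq j k" "x \<in> topspace (X k)"
    moreover have "q k i (v k x) = q j i (q k j (v k x))"
      using sys ijk v_in[of k x] unfolding G_inverse_system_def by blast
    ultimately show "u i (q k i (v k x)) = u i (q j i (v j (u j (q k j (v k x)))))"
      by (simp add: vu v_in q_in)
  qed
qed

section \<open>Right uniformly continuous functions\<close>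

lemma closedin_Collect_ball:
  assumes "\<And>i. i \<in> I \<Longrightarrow> closedin X {x \<in> topspace X. Q i x}"
  shows "closedin X {x \<in> topspace X. \<forall>i\<in>I. Q i x}"
proof (cases "I = {}")
  case False
  have "closedin X (\<Inter>i\<in>I. {x \<in> topspace X. Q i x})"
    using False assms by (rule closedin_INT)
  also have "(\<Inter>i\<in>I. {x \<in> topspace X. Q i x}) = {x \<in> topspace X. \<forall>i\<in>I. Q i x}"
    using False by auto
  finally show ?thesis .
qed simp

lemma continuous_map_euclidean_combine:
  assumes f: "continuous_map X euclidean f" and g: "continuous_map X euclidean g"
    and \<Phi>: "continuous_on UNIV \<Phi>"
  shows "continuous_map X euclidean (\<lambda>x. \<Phi> (f x, g x))"
proof -
  have "continuous_map X (prod_topology euclidean euclidean) (\<lambda>x. (f x, g x))"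
    using f g by (rule continuous_map_pairedI)
  moreover have "continuous_map euclidean euclidean \<Phi>" using \<Phi> by simp
  ultimately show ?thesis
    unfolding euclidean_product_topology
    using continuous_map_compose[of X euclidean "\<lambda>x. (f x, g x)" euclidean \<Phi>]
    by (simp add: o_def)
qed

locale topological_group_on = group G for G :: "'g monoid" (structure) +
  fixes T :: "'g topology"
  assumes topological_group: "topological_group G T"
begin

lemma topspace_T [simp]: "topspace T = carrier G"
  using topological_group by (simp add: topological_group_def)

lemma continuous_map_group_mult:
  assumes "continuous_map X T f" "continuous_map X T g"
  shows "continuous_map X T (\<lambda>x. f x \<otimes> g x)"
proof -
  have "continuous_map X (prod_topology T T) (\<lambda>x. (f x, g x))"
    using assms by (rule continuous_map_pairedI)
  then have "continuous_map X T ((\<lambda>(x, y). x \<otimes> y) \<circ> (\<lambda>x. (f x, g x)))"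
    using topological_group unfolding topological_group_def
    by (blast intro: continuous_map_compose)
  then show ?thesis by (simp add: o_def)
qed

lemma continuous_map_group_inv: "continuous_map T T (\<lambda>x. inv x)"
  using topological_group by (simp add: topological_group_def)

lemma RUCB_outside: "f \<in> RUCB G T \<Longrightarrow> x \<notin> carrier G \<Longrightarrow> f x = 0"
  by (simp add: RUCB_def)

lemma RUCB_bounded: "f \<in> RUCB G T \<Longrightarrow> bounded (f ` carrier G)"
  by (simp add: RUCB_def)

lemma RUCB_uniform:
  assumes "f \<in> RUCB G T" "e > 0"
  obtains V where "openin T V" "\<one> \<in> V"
    "\<And>x y. \<lbrakk>x \<in> carrier G; y \<in> carrier G; x \<otimes> inv y \<in> V\<rbrakk> \<Longrightarrow> cmod (f x - f y) < e"
proof -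
  have "\<forall>e>0. \<exists>V. openin T V \<and> \<one> \<in> V \<and>
      (\<forall>x\<in>carrier G. \<forall>y\<in>carrier G. x \<otimes> inv y \<in> V \<longrightarrow> cmod (f x - f y) < e)"
    using assms(1) by (simp add: RUCB_def)
  then obtain V where "openin T V \<and> \<one> \<in> V \<and>
      (\<forall>x\<in>carrier G. \<forall>y\<in>carrier G. x \<otimes> inv y \<in> V \<longrightarrow> cmod (f x - f y) < e)"
    using assms(2) by auto
  then show thesis by (intro that[of V]) auto
qed

text \<open>The joint range is bounded, so its closure is compact and \<Phi> is uniformly continuous
  there. Continuity is asked only on this closure so that inversion of functions bounded away from 0
  is covered too.\<close>

lemma RUCB_combine:
  assumes f: "f \<in> RUCB G T" and g: "g \<in> RUCB G T"
    and \<Phi>: "continuous_on (closure ((\<lambda>x. (f x, g x)) ` carrier G)) \<Phi>"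
  shows "(\<lambda>x. if x \<in> carrier G then \<Phi> (f x, g x) else 0) \<in> RUCB G T"
proof -
  let ?A = "(\<lambda>x. (f x, g x)) ` carrier G"
  have "?A \<subseteq> f ` carrier G \<times> g ` carrier G" by blast
  then have "bounded ?A"
    using bounded_Times RUCB_bounded f g bounded_subset by metis
  then have comp: "compact (closure ?A)" by (simp add: compact_closure)
  have "bounded (\<Phi> ` closure ?A)"
    using compact_continuous_image[OF \<Phi> comp] by (rule compact_imp_bounded)
  moreover have "(\<lambda>x. if x \<in> carrier G then \<Phi> (f x, g x) else 0) ` carrier G \<subseteq> \<Phi> ` closure ?A"
    using closure_subset by fastforce
  ultimately have "bounded ((\<lambda>x. if x \<in> carrier G then \<Phi> (f x, g x) else 0) ` carrier G)"
    by (rule bounded_subset)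
  moreover have "\<exists>V. openin T V \<and> \<one> \<in> V \<and> (\<forall>x\<in>carrier G. \<forall>y\<in>carrier G. x \<otimes> inv y \<in> V \<longrightarrow>
      cmod ((if x \<in> carrier G then \<Phi> (f x, g x) else 0) - (if y \<in> carrier G then \<Phi> (f y, g y) else 0)) < e)"
    if e: "e > 0" for e
  proof -
    obtain d where d: "d > 0"
      "\<And>a b. \<lbrakk>a \<in> closure ?A; b \<in> closure ?A; dist b a < d\<rbrakk> \<Longrightarrow> dist (\<Phi> b) (\<Phi> a) < e"
      using uniformly_continuous_onE[OF compact_uniformly_continuous[OF \<Phi> comp] e] by blast
    obtain U where U: "openin T U" "\<one> \<in> U"
      "\<And>x y. \<lbrakk>x \<in> carrier G; y \<in> carrier G; x \<otimes> inv y \<in> U\<rbrakk> \<Longrightarrow> cmod (f x - f y) < d / 2"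
      using RUCB_uniform[OF f, of "d / 2"] d(1) by (metis half_gt_zero)
    obtain V where V: "openin T V" "\<one> \<in> V"
      "\<And>x y. \<lbrakk>x \<in> carrier G; y \<in> carrier G; x \<otimes> inv y \<in> V\<rbrakk> \<Longrightarrow> cmod (g x - g y) < d / 2"
      using RUCB_uniform[OF g, of "d / 2"] d(1) by (metis half_gt_zero)
    have "cmod (\<Phi> (f x, g x) - \<Phi> (f y, g y)) < e"
      if xy: "x \<in> carrier G" "y \<in> carrier G" "x \<otimes> inv y \<in> U \<inter> V" for x y
    proof -
      have "dist (f x, g x) (f y, g y) \<le> dist (f x) (f y) + dist (g x) (g y)"
        unfolding dist_Pair_Pair by (rule order_trans[OF sqrt_sum_squares_le_sum]) auto
      also have "\<dots> < d" using U(3)[of x y] V(3)[of x y] xy by (simp add: dist_norm)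
      finally have "dist (f x, g x) (f y, g y) < d" .
      moreover have "(f x, g x) \<in> closure ?A" "(f y, g y) \<in> closure ?A"
        using xy by (simp_all add: closure_subset[THEN subsetD])
      ultimately show ?thesis using d(2) by (simp add: dist_norm)
    qed
    then show ?thesis
      using openin_Int[OF U(1) V(1)] U(2) V(2) by (intro exI[of _ "U \<inter> V"]) simp
  qed
  ultimately show ?thesis unfolding RUCB_def by simp
qed

lemma RUCB_zero: "(\<lambda>_. 0) \<in> RUCB G T"
  unfolding RUCB_def
proof (intro CollectI conjI allI impI ballI)
  fix e :: real assume "e > 0"
  then show "\<exists>V. openin T V \<and> \<one> \<in> V \<and>
      (\<forall>x\<in>carrier G. \<forall>y\<in>carrier G. x \<otimes> inv y \<in> V \<longrightarrow> cmod (0 - 0) < e)"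
    using openin_topspace[of T] by (intro exI[of _ "carrier G"]) auto
qed (auto simp: image_constant_conv)

lemma RUCB_combineI:
  assumes "f \<in> RUCB G T" "g \<in> RUCB G T"
    and "continuous_on (closure ((\<lambda>x. (f x, g x)) ` carrier G)) (\<lambda>z. \<Phi> (fst z) (snd z))"
    and "\<And>x. x \<in> carrier G \<Longrightarrow> F x = \<Phi> (f x) (g x)" "\<And>x. x \<notin> carrier G \<Longrightarrow> F x = 0"
  shows "F \<in> RUCB G T"
proof -
  have "F = (\<lambda>x. if x \<in> carrier G then \<Phi> (fst (f x, g x)) (snd (f x, g x)) else 0)"
    using assms(4,5) by auto
  then show ?thesis using RUCB_combine[OF assms(1-3)] by simp
qed

lemma RUCB_const: "(\<lambda>x. if x \<in> carrier G then c else 0) \<in> RUCB G T"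
  by (rule RUCB_combineI[OF RUCB_zero RUCB_zero, where \<Phi> = "\<lambda>_ _. c"])
     (auto intro!: continuous_intros)

lemma RUCB_add: "f \<in> RUCB G T \<Longrightarrow> g \<in> RUCB G T \<Longrightarrow> (\<lambda>x. f x + g x) \<in> RUCB G T"
  by (rule RUCB_combineI[where f = f and g = g and \<Phi> = "\<lambda>a b. a + b"])
     (auto intro!: continuous_intros simp: RUCB_outside)

lemma RUCB_mult: "f \<in> RUCB G T \<Longrightarrow> g \<in> RUCB G T \<Longrightarrow> (\<lambda>x. f x * g x) \<in> RUCB G T"
  by (rule RUCB_combineI[where f = f and g = g and \<Phi> = "\<lambda>a b. a * b"])
     (auto intro!: continuous_intros simp: RUCB_outside)

lemma RUCB_scale: "f \<in> RUCB G T \<Longrightarrow> (\<lambda>x. c * f x) \<in> RUCB G T"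
  by (rule RUCB_combineI[where f = f and g = f and \<Phi> = "\<lambda>a b. c * a"])
     (auto intro!: continuous_intros simp: RUCB_outside)

lemma RUCB_diff: "f \<in> RUCB G T \<Longrightarrow> g \<in> RUCB G T \<Longrightarrow> (\<lambda>x. f x - g x) \<in> RUCB G T"
  using RUCB_add[OF _ RUCB_scale[of g "-1"]] by simp

text \<open>The closed condition \<open>d \<le> cmod z\<close> passes from the range to its closure
  and keeps it away from 0. Off the carrier the convention \<open>inverse 0 = 0\<close> gives the
  prescribed value.\<close>

lemma RUCB_inverse:
  assumes f: "f \<in> RUCB G T" and d: "d > 0" "\<And>x. x \<in> carrier G \<Longrightarrow> d \<le> cmod (f x)"
  shows "(\<lambda>x. inverse (f x)) \<in> RUCB G T"
proof (rule RUCB_combineI[OF f f, where \<Phi> = "\<lambda>a b. inverse a"])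
  let ?A = "(\<lambda>x. (f x, f x)) ` carrier G"
  have "closed {z :: complex \<times> complex. d \<le> cmod (fst z)}"
    by (intro closed_Collect_le continuous_intros)
  then have "closure ?A \<subseteq> {z. d \<le> cmod (fst z)}"
    using d(2) by (intro closure_minimal) auto
  then have "fst z \<noteq> 0" if "z \<in> closure ?A" for z using that d(1) by fastforce
  then show "continuous_on (closure ?A) (\<lambda>z. inverse (fst z))"
    by (intro continuous_intros) auto
qed (simp_all add: RUCB_outside[OF f])

text \<open>Translating \<open>x\<close> and \<open>y\<close> by \<open>inv g\<close> conjugates
  their quotient \<open>x \<otimes> inv y\<close>, so the neighbourhood for \<open>f\<close> is
  pulled back along this continuous conjugation.\<close>

lemma left_transl_RUCB:
  assumes f: "f \<in> RUCB G T" and g: "g \<in> carrier G"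
  shows "left_transl G g f \<in> RUCB G T"
  unfolding RUCB_def
proof (intro CollectI conjI allI impI)
  show "left_transl G g f x = 0" if "x \<notin> carrier G" for x
    using that by (simp add: left_transl_def)
  have "left_transl G g f ` carrier G \<subseteq> f ` carrier G"
    using g by (auto simp: left_transl_def)
  then show "bounded (left_transl G g f ` carrier G)"
    using RUCB_bounded[OF f] bounded_subset by blast
  fix e :: real assume "e > 0"
  then obtain V where V: "openin T V" "\<one> \<in> V"
    "\<And>x y. \<lbrakk>x \<in> carrier G; y \<in> carrier G; x \<otimes> inv y \<in> V\<rbrakk> \<Longrightarrow> cmod (f x - f y) < e"
    using RUCB_uniform[OF f] by metis
  let ?U = "{x \<in> topspace T. inv g \<otimes> x \<otimes> g \<in> V}"
  have "continuous_map T T (\<lambda>x. inv g \<otimes> x \<otimes> g)"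
    using g by (intro continuous_map_group_mult) auto
  then have "openin T ?U" using V(1) by (rule openin_continuous_map_preimage)
  moreover have "\<one> \<in> ?U" using V(2) g by (simp add: l_inv)
  moreover have "cmod (left_transl G g f x - left_transl G g f y) < e"
    if "x \<in> carrier G" "y \<in> carrier G" "x \<otimes> inv y \<in> ?U" for x y
  proof -
    have "(inv g \<otimes> x) \<otimes> inv (inv g \<otimes> y) = inv g \<otimes> (x \<otimes> inv y) \<otimes> g"
      using that g by (simp add: inv_mult_group m_assoc)
    then show ?thesis
      using V(3)[of "inv g \<otimes> x" "inv g \<otimes> y"] that g by (simp add: left_transl_def)
  qed
  ultimately show "\<exists>U. openin T U \<and> \<one> \<in> U \<and> (\<forall>x\<in>carrier G. \<forall>y\<in>carrier G. x \<otimes> inv y \<in> U \<longrightarrow>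
      cmod (left_transl G g f x - left_transl G g f y) < e)"
    by blast
qed

lemma left_transl_one: "f \<in> RUCB G T \<Longrightarrow> left_transl G \<one> f = f"
  by (auto simp: left_transl_def fun_eq_iff RUCB_outside)

lemma left_transl_mult:
  "g \<in> carrier G \<Longrightarrow> h \<in> carrier G \<Longrightarrow> left_transl G (g \<otimes> h) f = left_transl G g (left_transl G h f)"
  by (auto simp: left_transl_def fun_eq_iff inv_mult_group m_assoc)

section \<open>The greatest ambit\<close>

abbreviation "ambit \<equiv> greatest_ambit G T"

lemma ambit_add:
  "\<lbrakk>\<phi> \<in> ambit; f \<in> RUCB G T; g \<in> RUCB G T\<rbrakk> \<Longrightarrow> \<phi> (\<lambda>x. f x + g x) = \<phi> f + \<phi> g"
  by (simp add: greatest_ambit_def)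

lemma ambit_scale: "\<lbrakk>\<phi> \<in> ambit; f \<in> RUCB G T\<rbrakk> \<Longrightarrow> \<phi> (\<lambda>x. c * f x) = c * \<phi> f"
  by (simp add: greatest_ambit_def)

lemma ambit_mult:
  "\<lbrakk>\<phi> \<in> ambit; f \<in> RUCB G T; g \<in> RUCB G T\<rbrakk> \<Longrightarrow> \<phi> (\<lambda>x. f x * g x) = \<phi> f * \<phi> g"
  by (simp add: greatest_ambit_def)

lemma ambit_diff:
  "\<lbrakk>\<phi> \<in> ambit; f \<in> RUCB G T; g \<in> RUCB G T\<rbrakk> \<Longrightarrow> \<phi> (\<lambda>x. f x - g x) = \<phi> f - \<phi> g"
  using ambit_add[of \<phi> f "\<lambda>x. -1 * g x"] ambit_scale[of \<phi> g "-1"] RUCB_scale[of g "-1"] by simp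

lemma ambit_sum:
  assumes "\<phi> \<in> ambit" "finite A" "\<And>i. i \<in> A \<Longrightarrow> f i \<in> RUCB G T"
  shows "(\<lambda>x. \<Sum>i\<in>A. f i x) \<in> RUCB G T \<and> \<phi> (\<lambda>x. \<Sum>i\<in>A. f i x) = (\<Sum>i\<in>A. \<phi> (f i))"
  using assms(2,3)
proof (induction A)
  case empty
  then show ?case using ambit_scale[OF assms(1) RUCB_zero, of 0] RUCB_zero by simp
next
  case (insert i A)
  then show ?case
    using ambit_add[OF assms(1), of "f i" "\<lambda>x. \<Sum>i\<in>A. f i x"] RUCB_add by simp
qed

lemma ambit_one:
  assumes \<phi>: "\<phi> \<in> ambit"
  shows "\<phi> (\<lambda>x. if x \<in> carrier G then 1 else 0) = 1"
proof -
  obtain f where f: "f \<in> RUCB G T" "\<phi> f \<noteq> 0" using \<phi> by (auto simp: greatest_ambit_def)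
  have "(\<lambda>x. f x * (if x \<in> carrier G then 1 else 0)) = f"
    using RUCB_outside[OF f(1)] by auto
  then show ?thesis using ambit_mult[OF \<phi> f(1) RUCB_const[of 1]] f(2) by simp
qed

text \<open>If \<open>\<phi> f\<close> exceeded the bound, \<open>f - \<phi> f\<close> would be an invertible element in the kernel.\<close>

lemma ambit_norm_le:
  assumes \<phi>: "\<phi> \<in> ambit" and f: "f \<in> RUCB G T" and B: "\<And>x. x \<in> carrier G \<Longrightarrow> cmod (f x) \<le> B"
  shows "cmod (\<phi> f) \<le> B"
proof (rule ccontr)
  assume "\<not> ?thesis"
  then have d: "cmod (\<phi> f) - B > 0" by simp
  let ?one = "\<lambda>x. if x \<in> carrier G then 1 else (0 :: complex)"
  define k where "k x = f x - \<phi> f * ?one x" for x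
  have k: "k \<in> RUCB G T"
    unfolding k_def by (intro RUCB_diff f RUCB_scale RUCB_const)
  have "\<phi> k = 0"
    unfolding k_def
    using ambit_diff[OF \<phi> f RUCB_scale[OF RUCB_const[of 1]]] ambit_scale[OF \<phi> RUCB_const[of 1]]
      ambit_one[OF \<phi>] by simp
  moreover have k_ge: "cmod (\<phi> f) - B \<le> cmod (k x)" if "x \<in> carrier G" for x
    using B[OF that] norm_triangle_ineq2[of "\<phi> f" "f x"] that
    by (simp add: k_def norm_minus_commute)
  moreover have "(\<lambda>x. k x * inverse (k x)) = ?one"
  proof
    fix x show "k x * inverse (k x) = ?one x"
    proof (cases "x \<in> carrier G")
      case True
      then have "k x \<noteq> 0" using k_ge[OF True] d by auto
      then show ?thesis using True by simp
    next
      case False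
      then show ?thesis by (simp add: RUCB_outside[OF k])
    qed
  qed
  ultimately show False
    using ambit_mult[OF \<phi> k RUCB_inverse[OF k d]] ambit_one[OF \<phi>] by simp
qed

text \<open>This character shows that the ambit, and with it each of its quotients, is
  nonempty.\<close>

lemma ambit_eval_one: "(\<lambda>f\<in>RUCB G T. f \<one>) \<in> ambit"
  unfolding greatest_ambit_def
  using RUCB_add RUCB_mult RUCB_scale RUCB_const[of 1]
  by (auto intro!: bexI[of _ "\<lambda>x. if x \<in> carrier G then 1 else 0"])

lemma ambit_act_closed:
  assumes \<phi>: "\<phi> \<in> ambit" and g: "g \<in> carrier G"
  shows "greatest_ambit_act G T g \<phi> \<in> ambit"
proof -
  let ?l = "left_transl G (inv g)"
  have l: "?l f \<in> RUCB G T" if "f \<in> RUCB G T" for f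
    using that g by (simp add: left_transl_RUCB)
  have "?l (\<lambda>x. f x + f' x) = (\<lambda>x. ?l f x + ?l f' x)" "?l (\<lambda>x. f x * f' x) = (\<lambda>x. ?l f x * ?l f' x)"
    "?l (\<lambda>x. c * f x) = (\<lambda>x. c * ?l f x)" for f f' c
    by (auto simp: left_transl_def fun_eq_iff)
  moreover have "?l (\<lambda>x. if x \<in> carrier G then 1 else 0) = (\<lambda>x. if x \<in> carrier G then 1 else 0)"
    using g by (auto simp: left_transl_def fun_eq_iff)
  ultimately show ?thesis
    unfolding greatest_ambit_def greatest_ambit_act_def
    using \<phi> l RUCB_add RUCB_mult RUCB_scale RUCB_const[of 1] ambit_one[OF \<phi>]
    by (auto simp: ambit_add ambit_mult ambit_scale
        intro!: bexI[of _ "\<lambda>x. if x \<in> carrier G then 1 else 0"])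
qed

lemma topspace_ambit: "topspace (greatest_ambit_top G T) = ambit"
  by (auto simp: greatest_ambit_top_def greatest_ambit_def PiE_iff extensional_def)

text \<open>As in the Banach-Alaoglu theorem: the characters form a closed subset of the product,
  and the norm bound confines them to a product of closed balls, which is compact by
  Tychonoff.\<close>

lemma compact_ambit: "compact_space (greatest_ambit_top G T)"
proof -
  let ?P = "product_topology (\<lambda>_. euclidean) (RUCB G T) :: (('g \<Rightarrow> complex) \<Rightarrow> complex) topology"
  let ?one = "\<lambda>x. if x \<in> carrier G then 1 else (0 :: complex)"
  have P: "topspace ?P = extensional (RUCB G T)" by (simp add: PiE_iff extensional_def set_eq_iff)
  have proj: "continuous_map ?P euclidean (\<lambda>\<phi>. \<phi> f)" if "f \<in> RUCB G T" for f
    using that by (rule continuous_map_product_projection)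
  have eq_closed: "closedin ?P {\<phi> \<in> topspace ?P. F \<phi> = F' \<phi>}"
    if "continuous_map ?P euclidean F" "continuous_map ?P euclidean F'"
    for F F' :: "(('g \<Rightarrow> complex) \<Rightarrow> complex) \<Rightarrow> complex"
    using that by (intro closedin_continuous_maps_eq[of euclidean]) auto
  have add: "continuous_map ?P euclidean (\<lambda>\<phi>. \<phi> f + \<phi> g)"
    and mult: "continuous_map ?P euclidean (\<lambda>\<phi>. \<phi> f * \<phi> g)"
    and scale: "continuous_map ?P euclidean (\<lambda>\<phi>. c * \<phi> f)"
    if "f \<in> RUCB G T" "g \<in> RUCB G T" for f g c
    using continuous_map_euclidean_combine[OF proj[OF that(1)] proj[OF that(2)], of "\<lambda>z. fst z + snd z"]
      continuous_map_euclidean_combine[OF proj[OF that(1)] proj[OF that(2)], of "\<lambda>z. fst z * snd z"]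
      continuous_map_euclidean_combine[OF proj[OF that(1)] proj[OF that(2)], of "\<lambda>z. c * fst z"]
    by (simp_all add: continuous_intros)
  \<comment> \<open>Being nonzero is not visibly a closed condition. For a multiplicative functional
    it amounts to taking the value 1 at the unit, which is closed.\<close>
  have ambit_eq: "ambit =
      {\<phi> \<in> topspace ?P. \<forall>f\<in>RUCB G T. \<forall>g\<in>RUCB G T. \<phi> (\<lambda>x. f x + g x) = \<phi> f + \<phi> g} \<inter>
      {\<phi> \<in> topspace ?P. \<forall>c\<in>UNIV. \<forall>f\<in>RUCB G T. \<phi> (\<lambda>x. c * f x) = c * \<phi> f} \<inter>
      {\<phi> \<in> topspace ?P. \<forall>f\<in>RUCB G T. \<forall>g\<in>RUCB G T. \<phi> (\<lambda>x. f x * g x) = \<phi> f * \<phi> g} \<inter>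
      {\<phi> \<in> topspace ?P. \<phi> ?one = 1}" (is "_ = ?C")
  proof
    show "ambit \<subseteq> ?C"
    proof
      fix \<phi> assume \<phi>: "\<phi> \<in> ambit"
      then have "\<phi> \<in> extensional (RUCB G T)" by (simp add: greatest_ambit_def)
      then show "\<phi> \<in> ?C"
        unfolding P using ambit_one[OF \<phi>] by (simp add: ambit_add[OF \<phi>] ambit_mult[OF \<phi>] ambit_scale[OF \<phi>])
    qed
    have "\<phi> \<in> ambit" if "\<phi> \<in> ?C" for \<phi>
    proof -
      have "\<exists>f\<in>RUCB G T. \<phi> f \<noteq> 0"
        using that RUCB_const[of 1] by (intro bexI[of _ ?one]) auto
      then show ?thesis using that unfolding P greatest_ambit_def by blast
    qed
    then show "?C \<subseteq> ambit" by blast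
  qed
  have "closedin ?P ambit"
    unfolding ambit_eq
  proof (intro closedin_Int closedin_Collect_ball eq_closed)
    show "continuous_map ?P euclidean (\<lambda>\<phi>. \<phi> ?one)" using RUCB_const[of 1] by (rule proj)
  qed (auto intro: proj add mult scale RUCB_add RUCB_mult RUCB_scale)
  moreover obtain B where B: "\<And>f x. f \<in> RUCB G T \<Longrightarrow> x \<in> carrier G \<Longrightarrow> cmod (f x) \<le> B f"
  proof -
    have "\<exists>b. \<forall>x\<in>carrier G. cmod (f x) \<le> b" if "f \<in> RUCB G T" for f
      using RUCB_bounded[OF that] by (auto simp: bounded_iff)
    then show ?thesis using that by metis
  qed
  have "ambit \<subseteq> Pi\<^sub>E (RUCB G T) (\<lambda>f. cball 0 (B f))"
  proof
    fix \<phi> assume \<phi>: "\<phi> \<in> ambit"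
    then have "cmod (\<phi> f) \<le> B f" if "f \<in> RUCB G T" for f
      by (intro ambit_norm_le[OF \<phi> that] B that)
    moreover have "\<phi> \<in> extensional (RUCB G T)" using \<phi> by (simp add: greatest_ambit_def)
    ultimately show "\<phi> \<in> Pi\<^sub>E (RUCB G T) (\<lambda>f. cball 0 (B f))" by (simp add: PiE_iff)
  qed
  moreover have "compactin ?P (Pi\<^sub>E (RUCB G T) (\<lambda>f. cball 0 (B f)))"
    by (simp add: compactin_PiE)
  ultimately have "compactin ?P ambit"
    by (metis closed_compactin)
  then show ?thesis
    unfolding greatest_ambit_top_def by (rule compact_space_subtopology)
qed

section \<open>Idempotents, their orbits, and separation of characters\<close>

definition "idems = {f \<in> RUCB G T. \<forall>x. f x * f x = f x}"

lemma idems_RUCB: "f \<in> idems \<Longrightarrow> f \<in> RUCB G T"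
  by (simp add: idems_def)

lemma ambit_idems:
  assumes "\<phi> \<in> ambit" "f \<in> idems"
  shows "\<phi> f = 0 \<or> \<phi> f = 1"
proof -
  have "f \<in> RUCB G T" "(\<lambda>x. f x * f x) = f" using assms(2) by (auto simp: idems_def)
  then have "\<phi> f * \<phi> f = \<phi> f" using ambit_mult[OF assms(1), of f f] by simp
  then show ?thesis by simp
qed

lemma left_transl_idems: "f \<in> idems \<Longrightarrow> g \<in> carrier G \<Longrightarrow> left_transl G g f \<in> idems"
  using left_transl_RUCB[of f g] by (auto simp: idems_def left_transl_def)

text \<open>The only values are 0 and 1, so an oscillation below 1 is no oscillation at all.\<close>

lemma idems_locally_constant:
  assumes f: "f \<in> idems"
  obtains V where "openin T V" "\<one> \<in> V"
    "\<And>x y. \<lbrakk>x \<in> carrier G; y \<in> carrier G; x \<otimes> inv y \<in> V\<rbrakk> \<Longrightarrow> f x = f y"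
proof -
  obtain V where V: "openin T V" "\<one> \<in> V"
    "\<And>x y. \<lbrakk>x \<in> carrier G; y \<in> carrier G; x \<otimes> inv y \<in> V\<rbrakk> \<Longrightarrow> cmod (f x - f y) < 1"
    using RUCB_uniform[OF idems_RUCB[OF f], of 1] by auto
  have "f x = 0 \<or> f x = 1" for x using f by (auto simp: idems_def)
  then have "f x = f y" if "cmod (f x - f y) < 1" for x y
    using that by (metis diff_0 diff_zero less_irrefl norm_minus_cancel norm_one)
  then show ?thesis using V that by blast
qed

lemma inv_cancel:
  assumes "x \<in> carrier G" "y \<in> carrier G" "z \<in> carrier G"
  shows "(x \<otimes> inv y) \<otimes> (y \<otimes> z) = x \<otimes> z"
proof -
  have "inv y \<otimes> (y \<otimes> z) = z" using assms by (simp add: m_assoc[symmetric])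
  then show ?thesis using assms by (simp add: m_assoc)
qed

text \<open>The quotient of \<open>g \<otimes> x\<close> by \<open>h \<otimes> x\<close> is
  \<open>g \<otimes> inv h\<close> whatever \<open>x\<close> is, so one neighbourhood serves all
  arguments at once.\<close>

lemma left_transl_inv_eq:
  assumes "g \<in> carrier G" "h \<in> carrier G" "g \<otimes> inv h \<in> V"
    and V: "\<And>x y. \<lbrakk>x \<in> carrier G; y \<in> carrier G; x \<otimes> inv y \<in> V\<rbrakk> \<Longrightarrow> f x = f y"
  shows "left_transl G (inv g) f = left_transl G (inv h) f"
proof
  fix x
  have "g \<otimes> x \<otimes> inv (h \<otimes> x) = g \<otimes> inv h" if "x \<in> carrier G"
  proof -
    have "x \<otimes> (inv x \<otimes> inv h) = inv h"
      using that assms(2) by (simp add: m_assoc[symmetric])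
    then show ?thesis using that assms(1,2) by (simp add: inv_mult_group m_assoc)
  qed
  then show "left_transl G (inv g) f x = left_transl G (inv h) f x"
    using assms(1-3) V[of "g \<otimes> x" "h \<otimes> x"] by (simp add: left_transl_def)
qed

lemma left_transl_locally_constant:
  assumes f: "f \<in> idems" and g: "g \<in> carrier G"
  obtains U where "openin T U" "g \<in> U" "\<And>h. h \<in> U \<Longrightarrow> left_transl G (inv h) f = left_transl G (inv g) f"
proof -
  obtain V where V: "openin T V" "\<one> \<in> V"
    "\<And>x y. \<lbrakk>x \<in> carrier G; y \<in> carrier G; x \<otimes> inv y \<in> V\<rbrakk> \<Longrightarrow> f x = f y"
    using idems_locally_constant[OF f] by metis
  let ?U = "{h \<in> topspace T. h \<otimes> inv g \<in> V}"
  have "continuous_map T T (\<lambda>h. h \<otimes> inv g)"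
    using g by (intro continuous_map_group_mult) auto
  then have "openin T ?U" using V(1) by (rule openin_continuous_map_preimage)
  moreover have "g \<in> ?U" using g V(2) by simp
  moreover have "left_transl G (inv h) f = left_transl G (inv g) f" if "h \<in> ?U" for h
    using that by (intro left_transl_inv_eq[where V = V] g V(3)) auto
  ultimately show ?thesis using that by blast
qed

text \<open>The orbit map of an idempotent is locally constant, so a countable dense set of group
  elements already attains all its values.\<close>

lemma countable_idems_orbit:
  assumes f: "f \<in> idems" and "separable_space T"
  shows "countable ((\<lambda>g. left_transl G g f) ` carrier G)"
proof -
  obtain D where D: "countable D" "D \<subseteq> carrier G" "T closure_of D = carrier G"
    using assms(2) by (auto simp: separable_space_def)
  have "left_transl G g f \<in> (\<lambda>g. left_transl G g f) ` D" if g: "g \<in> carrier G" for g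
  proof -
    obtain U where U: "openin T U" "inv g \<in> U"
      "\<And>h. h \<in> U \<Longrightarrow> left_transl G (inv h) f = left_transl G (inv (inv g)) f"
      using left_transl_locally_constant[OF f inv_closed[OF g]] by metis
    let ?W = "{h \<in> topspace T. inv h \<in> U}"
    have "openin T ?W"
      using continuous_map_group_inv U(1) by (rule openin_continuous_map_preimage)
    moreover have "g \<in> ?W" "g \<in> T closure_of D" using g U(2) D(3) by auto
    ultimately obtain d where d: "d \<in> D" "d \<in> ?W"
      unfolding in_closure_of by metis
    then have "left_transl G d f = left_transl G g f" using U(3)[of "inv d"] g by simp
    then show ?thesis using d(1) by (metis image_eqI)
  qed
  then have "(\<lambda>g. left_transl G g f) ` carrier G \<subseteq> (\<lambda>g. left_transl G g f) ` D" by blast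
  then show ?thesis using D(1) countable_image countable_subset by metis
qed

lemma step_function_RUCB:
  assumes H: "openin T H" "\<one> \<in> H" and fin: "finite (s ` carrier G)"
    and outside: "\<And>x. x \<notin> carrier G \<Longrightarrow> s x = 0"
    and const: "\<And>x y. \<lbrakk>x \<in> carrier G; y \<in> carrier G; x \<otimes> inv y \<in> H\<rbrakk> \<Longrightarrow> s x = s y"
  shows "s \<in> RUCB G T"
  unfolding RUCB_def
proof (intro CollectI conjI allI impI)
  fix e :: real assume "e > 0"
  then have "\<forall>x\<in>carrier G. \<forall>y\<in>carrier G. x \<otimes> inv y \<in> H \<longrightarrow> cmod (s x - s y) < e"
    using const by force
  then show "\<exists>V. openin T V \<and> \<one> \<in> V \<and>
      (\<forall>x\<in>carrier G. \<forall>y\<in>carrier G. x \<otimes> inv y \<in> V \<longrightarrow> cmod (s x - s y) < e)"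
    using H by blast
qed (use fin outside in \<open>auto simp: finite_imp_bounded\<close>)

text \<open>Each \<open>f\<close> in \<open>RUCB G T\<close> is uniformly approximated by a finite
  linear combination \<open>s\<close> of idempotents. The characters agree on \<open>s\<close>, and
  by \<open>ambit_norm_le\<close> neither of them enlarges the error.\<close>

lemma ambit_eqI:
  assumes na: "non_archimedean G T" and \<phi>: "\<phi> \<in> ambit" and \<psi>: "\<psi> \<in> ambit"
    and eq: "\<And>f. f \<in> idems \<Longrightarrow> \<phi> f = \<psi> f"
  shows "\<phi> = \<psi>"
proof
  fix f show "\<phi> f = \<psi> f"
  proof (cases "f \<in> RUCB G T")
    case False
    then show ?thesis using \<phi> \<psi> by (simp add: greatest_ambit_def extensional_def)
  next
    case f: True
    have "dist (\<phi> f) (\<psi> f) \<le> e" if e: "e > 0" for e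
    proof -
      \<comment> \<open>Passing from \<open>f\<close> to \<open>s\<close> costs one \<epsilon> for
        the coset representative and one for rounding the value; this is paid for each of the two
        characters.\<close>
      define \<epsilon> where "\<epsilon> = e / 4"
      have \<epsilon>: "\<epsilon> > 0" using e by (simp add: \<epsilon>_def)
      obtain V where V: "openin T V" "\<one> \<in> V"
        "\<And>x y. \<lbrakk>x \<in> carrier G; y \<in> carrier G; x \<otimes> inv y \<in> V\<rbrakk> \<Longrightarrow> cmod (f x - f y) < \<epsilon>"
        using RUCB_uniform[OF f \<epsilon>] by metis
      \<comment> \<open>Since \<open>H\<close> is a subgroup,
        \<open>x \<otimes> inv y \<in> H\<close> is an equivalence relation with the right cosets as
        classes. This lets \<open>r\<close> choose one representative for a whole coset.\<close>
      obtain H where H: "subgroup H G" "openin T H" "H \<subseteq> V"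
        using na V(1,2) unfolding non_archimedean_def by metis
      obtain K where K: "finite K" "closure (f ` carrier G) \<subseteq> (\<Union>c\<in>K. ball c \<epsilon>)"
        using RUCB_bounded[OF f] \<epsilon> compact_closure[of "f ` carrier G"]
        unfolding compact_eq_totally_bounded by metis
      define r where "r x = (SOME y. y \<in> carrier G \<and> x \<otimes> inv y \<in> H)" for x
      have r: "r x \<in> carrier G \<and> x \<otimes> inv (r x) \<in> H" if x: "x \<in> carrier G" for x
        unfolding r_def
      proof (rule someI)
        show "x \<in> carrier G \<and> x \<otimes> inv x \<in> H" using x H(1) by (simp add: subgroup.one_closed)
      qed
      have r_eq: "r x = r y" if xy: "x \<in> carrier G" "y \<in> carrier G" "x \<otimes> inv y \<in> H" for x y
      proof -
        have yx: "y \<otimes> inv x \<in> H"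
          using subgroup.m_inv_closed[OF H(1) xy(3)] xy by (simp add: inv_mult_group)
        have "x \<otimes> inv z \<in> H \<longleftrightarrow> y \<otimes> inv z \<in> H" if z: "z \<in> carrier G" for z
        proof -
          have "x \<otimes> inv z = (x \<otimes> inv y) \<otimes> (y \<otimes> inv z)" "y \<otimes> inv z = (y \<otimes> inv x) \<otimes> (x \<otimes> inv z)"
            using xy z by (simp_all add: inv_cancel)
          then show ?thesis
            using subgroup.m_closed[OF H(1)] xy(3) yx by metis
        qed
        then have "(\<lambda>z. z \<in> carrier G \<and> x \<otimes> inv z \<in> H) = (\<lambda>z. z \<in> carrier G \<and> y \<otimes> inv z \<in> H)"
          by blast
        then show ?thesis unfolding r_def by simp
      qed
      \<comment> \<open>There may be infinitely many cosets, and their indicators would give an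
        infinite sum. Rounding to the finite net \<open>K\<close> leaves finitely many level sets,
        each a union of cosets.\<close>
      define t where "t z = (SOME c. c \<in> K \<and> z \<in> ball c \<epsilon>)" for z
      have t: "t (f x) \<in> K \<and> f x \<in> ball (t (f x)) \<epsilon>" if x: "x \<in> carrier G" for x
        unfolding t_def
      proof (rule someI_ex)
        have "f x \<in> closure (f ` carrier G)" using x by (simp add: closure_subset[THEN subsetD])
        then show "\<exists>c. c \<in> K \<and> f x \<in> ball c \<epsilon>" using K(2) by blast
      qed
      define s where "s x = (if x \<in> carrier G then t (f (r x)) else 0)" for x
      define ind where "ind c x = (if x \<in> carrier G \<and> s x = c then 1 else (0::complex))" for c x
      have s_in: "s x \<in> K" if "x \<in> carrier G" for x
        using that r t by (simp add: s_def)
      have one: "\<one> \<in> H" using H(1) by (rule subgroup.one_closed)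
      have ind: "ind c \<in> idems" for c
      proof -
        have "ind c \<in> RUCB G T"
        proof (rule step_function_RUCB[OF H(2) one])
          have "ind c ` carrier G \<subseteq> {0, 1}" by (auto simp: ind_def)
          then show "finite (ind c ` carrier G)" by (rule finite_subset) simp
        next
          show "ind c x = ind c y" if "x \<in> carrier G" "y \<in> carrier G" "x \<otimes> inv y \<in> H" for x y
            using r_eq[OF that] that by (simp add: ind_def s_def)
        qed (simp add: ind_def)
        then show ?thesis by (simp add: idems_def ind_def)
      qed
      have s_sum: "s = (\<lambda>x. \<Sum>c\<in>K. c * ind c x)"
      proof
        fix x show "s x = (\<Sum>c\<in>K. c * ind c x)"
        proof (cases "x \<in> carrier G")
          case True
          then have "(\<Sum>c\<in>K. c * ind c x) = (\<Sum>c\<in>K. if c = s x then c else 0)"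
            by (intro sum.cong) (auto simp: ind_def)
          then show ?thesis using K(1) s_in[OF True] by simp
        qed (simp add: s_def ind_def)
      qed
      have s_R: "s \<in> RUCB G T" and \<phi>_s: "\<phi> s = (\<Sum>c\<in>K. c * \<phi> (ind c))"
        and \<psi>_s: "\<psi> s = (\<Sum>c\<in>K. c * \<psi> (ind c))"
        unfolding s_sum
        using ambit_sum[OF \<phi> K(1), of "\<lambda>c x. c * ind c x"] ambit_sum[OF \<psi> K(1), of "\<lambda>c x. c * ind c x"]
          idems_RUCB[OF ind] RUCB_scale ambit_scale[OF \<phi>] ambit_scale[OF \<psi>] by simp_all
      have close: "cmod (f x - s x) \<le> 2 * \<epsilon>" if x: "x \<in> carrier G" for x
      proof -
        have "cmod (f x - f (r x)) < \<epsilon>" using V(3)[OF x] r[OF x] H(3) by blast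
        moreover have "cmod (f (r x) - s x) < \<epsilon>"
          using t[of "r x"] r[OF x] x by (simp add: s_def dist_norm norm_minus_commute)
        ultimately show ?thesis using norm_triangle_ineq[of "f x - f (r x)" "f (r x) - s x"] by simp
      qed
      have "dist (\<theta> f) (\<theta> s) \<le> 2 * \<epsilon>" if "\<theta> \<in> ambit" for \<theta>
        using ambit_norm_le[OF that RUCB_diff[OF f s_R] close] ambit_diff[OF that f s_R]
        by (simp add: dist_norm)
      moreover have "\<phi> s = \<psi> s" unfolding \<phi>_s \<psi>_s using eq[OF ind] by simp
      ultimately have "dist (\<phi> f) (\<psi> f) \<le> 2 * \<epsilon> + 2 * \<epsilon>"
        using \<phi> \<psi> dist_triangle2[of "\<phi> f" "\<psi> f" "\<phi> s"] by (metis add_mono order_trans)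
      then show ?thesis by (simp add: \<epsilon>_def)
    qed
    then have "dist (\<phi> f) (\<psi> f) \<le> 0" by (rule field_le_epsilon) simp
    then show ?thesis by simp
  qed
qed

section \<open>Cantor quotients of the greatest ambit\<close>

text \<open>Intersecting with \<open>idems\<close> allows \<open>E\<close> to be any finite subset
  of \<open>RUCB G T\<close>; the other members of \<open>E\<close> only enlarge the index without
  changing the quotient.\<close>

definition "orbits E = (\<Union>f\<in>E \<inter> idems. (\<lambda>g. left_transl G g f) ` carrier G)"

lemma orbits_idems: "f \<in> orbits E \<Longrightarrow> f \<in> idems"
  by (auto simp: orbits_def left_transl_idems)

lemma orbits_RUCB: "f \<in> orbits E \<Longrightarrow> f \<in> RUCB G T"
  by (blast intro: orbits_idems idems_RUCB)

lemma orbits_mono: "E \<subseteq> F \<Longrightarrow> orbits E \<subseteq> orbits F"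
  by (auto simp: orbits_def)

lemma subset_orbits: "f \<in> E \<Longrightarrow> f \<in> idems \<Longrightarrow> f \<in> orbits E"
  unfolding orbits_def
  by (intro UN_I[of f] image_eqI[of _ _ \<one>]) (auto simp: left_transl_one idems_RUCB)

lemma left_transl_orbits:
  assumes "f \<in> orbits E" "g \<in> carrier G"
  shows "left_transl G g f \<in> orbits E"
proof -
  obtain f' h where f': "f' \<in> E \<inter> idems" "h \<in> carrier G" "f = left_transl G h f'"
    using assms(1) by (auto simp: orbits_def)
  then have "left_transl G g f = left_transl G (g \<otimes> h) f'"
    using assms(2) by (simp add: left_transl_mult)
  then show ?thesis
    unfolding orbits_def using f' assms(2) by (intro UN_I[of f'] image_eqI[of _ _ "g \<otimes> h"]) auto
qed

lemma countable_orbits: "\<lbrakk>separable_space T; finite E\<rbrakk> \<Longrightarrow> countable (orbits E)"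
  unfolding orbits_def by (intro countable_UN countable_idems_orbit) (auto intro: countable_finite)

definition "ambit_quot E = subtopology (product_topology (\<lambda>_. euclidean) (orbits E)) ((\<lambda>\<phi>. restrict \<phi> (orbits E)) ` ambit)"

definition ambit_quot_act :: "('g \<Rightarrow> complex) set \<Rightarrow> 'g \<Rightarrow>
    (('g \<Rightarrow> complex) \<Rightarrow> complex) \<Rightarrow> ('g \<Rightarrow> complex) \<Rightarrow> complex" where
  "ambit_quot_act E g x = (\<lambda>f\<in>orbits E. x (left_transl G (inv g) f))"

lemma topspace_ambit_quot: "topspace (ambit_quot E) = (\<lambda>\<phi>. restrict \<phi> (orbits E)) ` ambit"
  by (auto simp: ambit_quot_def PiE_iff)

lemma continuous_map_ambit_quot:
  "continuous_map (greatest_ambit_top G T) (ambit_quot E) (\<lambda>\<phi>. restrict \<phi> (orbits E))"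
proof -
  have "continuous_map (greatest_ambit_top G T) euclidean (\<lambda>\<phi>. \<phi> f)" if "f \<in> orbits E" for f
    unfolding greatest_ambit_top_def
    by (intro continuous_map_from_subtopology continuous_map_product_projection orbits_RUCB[OF that])
  then have "continuous_map (greatest_ambit_top G T) (product_topology (\<lambda>_. euclidean) (orbits E))
      (\<lambda>\<phi>. restrict \<phi> (orbits E))"
    by (auto simp: continuous_map_componentwise)
  then show ?thesis
    unfolding ambit_quot_def continuous_map_in_subtopology topspace_ambit by blast
qed

lemma compact_ambit_quot: "compact_space (ambit_quot E)"
proof -
  have "compactin (ambit_quot E) ((\<lambda>\<phi>. restrict \<phi> (orbits E)) ` topspace (greatest_ambit_top G T))"
    using compact_ambit continuous_map_ambit_quot
    unfolding compact_space_def by (rule image_compactin)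
  then show ?thesis by (simp add: compact_space_def topspace_ambit topspace_ambit_quot)
qed

lemma ambit_quot_values: "x \<in> topspace (ambit_quot E) \<Longrightarrow> f \<in> orbits E \<Longrightarrow> x f = 0 \<or> x f = 1"
  using ambit_idems[OF _ orbits_idems] by (force simp: topspace_ambit_quot)

lemma ambit_quot_extensional: "x \<in> topspace (ambit_quot E) \<Longrightarrow> x \<in> extensional (orbits E)"
  by (auto simp: topspace_ambit_quot)

lemma openin_ambit_quot_coordinate:
  assumes f: "f \<in> orbits E" and x: "x \<in> topspace (ambit_quot E)"
  shows "openin (ambit_quot E) {y \<in> topspace (ambit_quot E). y f = x f}"
proof -
  have "continuous_map (ambit_quot E) euclidean (\<lambda>y. y f)"
    unfolding ambit_quot_def using f
    by (intro continuous_map_from_subtopology continuous_map_product_projection)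
  \<comment> \<open>Coordinates take only the values 0 and 1, and the open ball of radius 1 about
    either value omits the other.\<close>
  then have "openin (ambit_quot E) {y \<in> topspace (ambit_quot E). y f \<in> ball (x f) 1}"
    by (rule openin_continuous_map_preimage) simp
  also have "{y \<in> topspace (ambit_quot E). y f \<in> ball (x f) 1} = {y \<in> topspace (ambit_quot E). y f = x f}"
  proof -
    have "y f \<in> ball (x f) 1 \<longleftrightarrow> y f = x f" if "y \<in> topspace (ambit_quot E)" for y
      using ambit_quot_values[OF that f] ambit_quot_values[OF x f] by (auto simp: dist_norm)
    then show ?thesis by blast
  qed
  finally show ?thesis .
qed

lemma ambit_quot_act_restrict:
  "g \<in> carrier G \<Longrightarrow> ambit_quot_act E g (restrict \<phi> (orbits E)) = restrict (greatest_ambit_act G T g \<phi>) (orbits E)"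
  by (auto simp: ambit_quot_act_def greatest_ambit_act_def fun_eq_iff left_transl_orbits orbits_RUCB)

text \<open>Near \<open>g\<close> the translate of \<open>f\<close> does not change, so the
  coordinate \<open>f\<close> of the action is there a single fixed coordinate of \<open>x\<close>,
  itself locally constant. This gives continuity in both variables together.\<close>

lemma G_space_ambit_quot: "G_space G T (ambit_quot E) (ambit_quot_act E)"
  unfolding G_space_def
proof (intro conjI ballI)
  show act_in: "ambit_quot_act E g x \<in> topspace (ambit_quot E)" if "g \<in> carrier G" "x \<in> topspace (ambit_quot E)" for g x
    using that ambit_act_closed by (auto simp: topspace_ambit_quot ambit_quot_act_restrict)
  show "ambit_quot_act E \<one> x = x" if "x \<in> topspace (ambit_quot E)" for x
    using ambit_quot_extensional[OF that]
    by (auto simp: ambit_quot_act_def fun_eq_iff left_transl_one orbits_RUCB extensional_def)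
  show "ambit_quot_act E (g \<otimes> h) x = ambit_quot_act E g (ambit_quot_act E h x)"
    if "g \<in> carrier G" "h \<in> carrier G" "x \<in> topspace (ambit_quot E)" for g h x
    using that by (auto simp: ambit_quot_act_def fun_eq_iff inv_mult_group left_transl_mult left_transl_orbits)
  have "continuous_map (prod_topology T (ambit_quot E)) euclidean (\<lambda>z. ambit_quot_act E (fst z) (snd z) f)"
    if f: "f \<in> orbits E" for f
  proof (rule locally_constant_imp_continuous_map)
    fix z assume "z \<in> topspace (prod_topology T (ambit_quot E))"
    then obtain g x where z: "z = (g, x)" "g \<in> carrier G" "x \<in> topspace (ambit_quot E)" by auto
    obtain U where U: "openin T U" "g \<in> U"
      "\<And>h. h \<in> U \<Longrightarrow> left_transl G (inv h) f = left_transl G (inv g) f"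
      using left_transl_locally_constant[OF orbits_idems[OF f] z(2)] by metis
    let ?f = "left_transl G (inv g) f"
    let ?W = "{y \<in> topspace (ambit_quot E). y ?f = x ?f}"
    have "openin (ambit_quot E) ?W"
      using f z(2,3) by (intro openin_ambit_quot_coordinate left_transl_orbits) auto
    then have "openin (prod_topology T (ambit_quot E)) (U \<times> ?W)"
      using U(1) by (simp add: openin_prod_Times_iff)
    moreover have "z \<in> U \<times> ?W" using z U(2) by simp
    moreover have "\<forall>z'\<in>U \<times> ?W. ambit_quot_act E (fst z') (snd z') f = ambit_quot_act E (fst z) (snd z) f"
      using f U(3) z(1) by (auto simp: ambit_quot_act_def)
    ultimately show "\<exists>U. openin (prod_topology T (ambit_quot E)) U \<and> z \<in> U \<and>
        (\<forall>z'\<in>U. ambit_quot_act E (fst z') (snd z') f = ambit_quot_act E (fst z) (snd z) f)"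
      by blast
  qed simp
  then have "continuous_map (prod_topology T (ambit_quot E)) (product_topology (\<lambda>_. euclidean) (orbits E))
      (\<lambda>z. ambit_quot_act E (fst z) (snd z))"
    by (auto simp: continuous_map_componentwise ambit_quot_act_def)
  moreover have "(\<lambda>z. ambit_quot_act E (fst z) (snd z)) ` topspace (prod_topology T (ambit_quot E))
      \<subseteq> (\<lambda>\<phi>. restrict \<phi> (orbits E)) ` ambit"
    using act_in unfolding topspace_ambit_quot[symmetric] by auto
  ultimately show "continuous_map (prod_topology T (ambit_quot E)) (ambit_quot E) (\<lambda>(g, x). ambit_quot_act E g x)"
    unfolding case_prod_unfold
    by (subst (2) ambit_quot_def) (simp add: continuous_map_in_subtopology image_subset_iff_funcset)
qed

lemma ambit_quot_embeds_in_Cantor_space: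
  assumes "countable (orbits E)"
  shows "\<exists>d. continuous_map (ambit_quot E) Cantor_space d \<and> inj_on d (topspace (ambit_quot E))"
proof (intro exI conjI)
  let ?e = "from_nat_into (orbits E)"
  \<comment> \<open>\<open>from_nat_into\<close> yields an unspecified function when there are no
    orbits; the guard makes \<open>d\<close> constant in that case, where the quotient is a single
    point.\<close>
  define d where "d x n \<longleftrightarrow> orbits E \<noteq> {} \<and> x (?e n) = 1" for x :: "('g \<Rightarrow> complex) \<Rightarrow> complex" and n
  have "continuous_map (ambit_quot E) (discrete_topology UNIV) (\<lambda>x. d x n)" for n
  proof (rule locally_constant_imp_continuous_map)
    fix x assume x: "x \<in> topspace (ambit_quot E)"
    show "\<exists>U. openin (ambit_quot E) U \<and> x \<in> U \<and> (\<forall>y\<in>U. d y n = d x n)"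
    proof (cases "orbits E = {}")
      case True
      then show ?thesis using x by (intro exI[of _ "topspace (ambit_quot E)"]) (simp add: d_def)
    next
      case False
      then have "?e n \<in> orbits E" by (rule from_nat_into)
      then show ?thesis
        using openin_ambit_quot_coordinate[OF _ x] x
        by (intro exI[of _ "{y \<in> topspace (ambit_quot E). y (?e n) = x (?e n)}"]) (simp add: d_def)
    qed
  qed simp
  then show "continuous_map (ambit_quot E) Cantor_space d" by (simp add: continuous_map_Cantor_space)
  show "inj_on d (topspace (ambit_quot E))"
  proof (rule inj_onI, rule ext)
    fix x y f assume xy: "x \<in> topspace (ambit_quot E)" "y \<in> topspace (ambit_quot E)" "d x = d y"
    show "x f = y f"
    proof (cases "f \<in> orbits E")
      case True
      then have "?e (to_nat_on (orbits E) f) = f" "orbits E \<noteq> {}" using assms by auto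
      then have "x f = 1 \<longleftrightarrow> y f = 1"
        using fun_cong[OF xy(3), of "to_nat_on (orbits E) f"] by (simp add: d_def)
      then show ?thesis using ambit_quot_values[OF xy(1) True] ambit_quot_values[OF xy(2) True] by auto
    next
      case False
      then show ?thesis
        using ambit_quot_extensional[OF xy(1)] ambit_quot_extensional[OF xy(2)] by (simp add: extensional_def)
    qed
  qed
qed

text \<open>The trivial factor \<open>Cantor_space\<close> makes every space of the system perfect. Since the proper
  bonding maps are constant in that coordinate and the index set has no maximal element, the
  factor does not contribute to the inverse limit.\<close>

definition "thick E = prod_topology (ambit_quot E) Cantor_space"

definition "thick_act E g z = (ambit_quot_act E g (fst z), snd z)"

text \<open>The identity law of an inverse system forbids collapsing when the indices agree. The
  constant \<open>False\<close> sequence is an arbitrary choice: the action on the Cantor factor is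
  trivial, so every point of it is fixed.\<close>

definition thick_bond :: "('g \<Rightarrow> complex) set \<Rightarrow> ('g \<Rightarrow> complex) set \<Rightarrow>
    (('g \<Rightarrow> complex) \<Rightarrow> complex) \<times> (nat \<Rightarrow> bool) \<Rightarrow> (('g \<Rightarrow> complex) \<Rightarrow> complex) \<times> (nat \<Rightarrow> bool)" where
  "thick_bond F E z = (if E = F then z else (restrict (fst z) (orbits E), \<lambda>_. False))"

lemma topspace_thick: "topspace (thick E) = topspace (ambit_quot E) \<times> UNIV"
  by (simp add: thick_def)

lemma thick_homeomorphic_Cantor_space:
  assumes "separable_space T" "finite E"
  shows "thick E homeomorphic_space Cantor_space"
proof -
  obtain d where "continuous_map (ambit_quot E) Cantor_space d" "inj_on d (topspace (ambit_quot E))"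
    using ambit_quot_embeds_in_Cantor_space countable_orbits[OF assms] by metis
  moreover have "topspace (ambit_quot E) \<noteq> {}" using ambit_eval_one by (auto simp: topspace_ambit_quot)
  ultimately show ?thesis
    unfolding thick_def using compact_ambit_quot by (intro prod_Cantor_space_homeomorphic)
qed

lemma G_space_thick: "G_space G T (thick E) (thick_act E)"
proof -
  have act: "continuous_map (prod_topology T (ambit_quot E)) (ambit_quot E) (\<lambda>(g, x). ambit_quot_act E g x)"
    using G_space_ambit_quot by (simp add: G_space_def)
  have "continuous_map (prod_topology T (thick E)) (prod_topology T (ambit_quot E)) (\<lambda>z. (fst z, fst (snd z)))"
    unfolding thick_def
    by (intro continuous_map_pairedI continuous_map_fst
        continuous_map_compose[OF continuous_map_snd continuous_map_fst, unfolded o_def])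
  from continuous_map_compose[OF this act]
  have "continuous_map (prod_topology T (thick E)) (ambit_quot E) (\<lambda>z. ambit_quot_act E (fst z) (fst (snd z)))"
    by (simp add: o_def)
  moreover have "continuous_map (prod_topology T (thick E)) Cantor_space (\<lambda>z. snd (snd z))"
    unfolding thick_def
    by (rule continuous_map_compose[OF continuous_map_snd continuous_map_snd, unfolded o_def])
  ultimately have "continuous_map (prod_topology T (thick E)) (thick E)
      (\<lambda>z. (ambit_quot_act E (fst z) (fst (snd z)), snd (snd z)))"
    by (subst (2) thick_def) (rule continuous_map_pairedI)
  then have "continuous_map (prod_topology T (thick E)) (thick E) (\<lambda>(g, z). thick_act E g z)"
    by (simp add: thick_act_def case_prod_unfold)
  moreover have "\<forall>g\<in>carrier G. \<forall>z\<in>topspace (thick E). thick_act E g z \<in> topspace (thick E)"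
    "\<forall>z\<in>topspace (thick E). thick_act E \<one> z = z"
    "\<forall>g\<in>carrier G. \<forall>h\<in>carrier G. \<forall>z\<in>topspace (thick E).
      thick_act E (g \<otimes> h) z = thick_act E g (thick_act E h z)"
    using G_space_ambit_quot[of E] by (auto simp: G_space_def topspace_thick thick_act_def)
  ultimately show ?thesis unfolding G_space_def by blast
qed

lemma restrict_ambit_quot_in:
  assumes "E \<subseteq> F" "x \<in> topspace (ambit_quot F)"
  shows "restrict x (orbits E) \<in> topspace (ambit_quot E)"
proof -
  obtain \<phi> where "\<phi> \<in> ambit" "x = restrict \<phi> (orbits F)" using assms(2) by (auto simp: topspace_ambit_quot)
  moreover have "orbits F \<inter> orbits E = orbits E" using orbits_mono[OF assms(1)] by blast
  ultimately show ?thesis by (simp add: topspace_ambit_quot)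
qed

lemma continuous_map_ambit_quot_restrict:
  assumes "E \<subseteq> F"
  shows "continuous_map (ambit_quot F) (ambit_quot E) (\<lambda>x. restrict x (orbits E))"
proof -
  have "continuous_map (ambit_quot F) euclidean (\<lambda>x. x f)" if "f \<in> orbits E" for f
    unfolding ambit_quot_def using that orbits_mono[OF assms]
    by (intro continuous_map_from_subtopology continuous_map_product_projection) blast
  then have "continuous_map (ambit_quot F) (product_topology (\<lambda>_. euclidean) (orbits E)) (\<lambda>x. restrict x (orbits E))"
    by (auto simp: continuous_map_componentwise)
  moreover have "(\<lambda>x. restrict x (orbits E)) ` topspace (ambit_quot F) \<subseteq> (\<lambda>\<phi>. restrict \<phi> (orbits E)) ` ambit"
    using restrict_ambit_quot_in[OF assms] unfolding topspace_ambit_quot[of E, symmetric] by blast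
  ultimately show ?thesis
    by (subst (2) ambit_quot_def) (simp add: continuous_map_in_subtopology image_subset_iff_funcset)
qed

lemma continuous_map_thick_bond:
  assumes "E \<subseteq> F"
  shows "continuous_map (thick F) (thick E) (thick_bond F E)"
proof (cases "E = F")
  case True
  then have eq: "thick_bond F E = (\<lambda>z. z)" by (simp add: thick_bond_def fun_eq_iff)
  show ?thesis unfolding eq using True by simp
next
  case False
  have "continuous_map (thick F) (ambit_quot E) (\<lambda>z. restrict (fst z) (orbits E))"
    unfolding thick_def
    by (rule continuous_map_compose[OF continuous_map_fst continuous_map_ambit_quot_restrict[OF assms], unfolded o_def])
  then have "continuous_map (thick F) (thick E) (\<lambda>z. (restrict (fst z) (orbits E), \<lambda>_. False))"
    by (subst (2) thick_def) (intro continuous_map_pairedI, simp_all)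
  then show ?thesis using False by (simp add: thick_bond_def[abs_def])
qed

lemma equivariant_thick_bond:
  assumes "E \<subseteq> F"
  shows "equivariant G (thick F) (thick_act F) (thick_act E) (thick_bond F E)"
proof -
  have "restrict (ambit_quot_act F g x) (orbits E) = ambit_quot_act E g (restrict x (orbits E))" if "g \<in> carrier G" for g x
    using orbits_mono[OF assms] that
    by (auto simp: ambit_quot_act_def fun_eq_iff left_transl_orbits)
  then show ?thesis by (auto simp: equivariant_def thick_bond_def thick_act_def)
qed

lemma G_inverse_system_thick:
  "G_inverse_system G T {E. finite E \<and> E \<subseteq> RUCB G T} (\<subseteq>) thick thick_act thick_bond"
  unfolding G_inverse_system_def
proof (intro conjI ballI impI)
  show "directed_set {E. finite E \<and> E \<subseteq> RUCB G T} (\<subseteq>)"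
    unfolding directed_set_def
  proof (intro conjI ballI)
    show "\<exists>k\<in>{E. finite E \<and> E \<subseteq> RUCB G T}. E \<subseteq> k \<and> F \<subseteq> k"
      if "E \<in> {E. finite E \<and> E \<subseteq> RUCB G T}" "F \<in> {E. finite E \<and> E \<subseteq> RUCB G T}" for E F
      using that by (intro bexI[of _ "E \<union> F"]) auto
  qed auto
next
  fix E F D :: "('g \<Rightarrow> complex) set" and z
  assume sub: "E \<subseteq> F \<and> F \<subseteq> D"
  have *: "orbits F \<inter> orbits E = orbits E" using orbits_mono[of E F] sub by blast
  show "thick_bond D E z = thick_bond F E (thick_bond D F z)"
  \<comment> \<open>If \<open>E\<close> and \<open>D\<close> differ, at least one of the two
    inclusions is proper, so the composite collapses the Cantor coordinate just as the direct bond
    does.\<close>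
  proof (cases "E = D")
    case True
    then have "F = E" using sub by blast
    then show ?thesis using True by (simp add: thick_bond_def)
  next
    case False
    then show ?thesis using * by (auto simp: thick_bond_def)
  qed
qed (auto simp: G_space_thick continuous_map_thick_bond equivariant_thick_bond thick_bond_def)

text \<open>This is what gives every finite index a proper successor, and hence a bonding map that
  collapses the Cantor factor.\<close>

lemma infinite_RUCB: "infinite (RUCB G T)"
proof -
  have "inj (\<lambda>c x. if x \<in> carrier G then c else 0 :: complex)"
    by (rule injI) (metis one_closed)
  moreover have "range (\<lambda>c x. if x \<in> carrier G then c else 0 :: complex) \<subseteq> RUCB G T"
    using RUCB_const by blast
  ultimately show ?thesis
    using infinite_UNIV_char_0[where 'a = complex] finite_imageD finite_subset by metis
qed

end

section \<open>Assembling the inverse system on sequences of reals\<close>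

lemma Cantor_space_homeomorphic_real_sequences:
  "Cantor_space homeomorphic_space
    product_topology (\<lambda>_::nat. discrete_topology {0, 1::real}) UNIV" (is "_ homeomorphic_space ?K")
proof -
  have "homeomorphic_maps Cantor_space ?K (\<lambda>x n. of_bool (x n)) (\<lambda>y n. y n = 1)"
    unfolding homeomorphic_maps_def
  proof (intro conjI ballI)
    have proj: "continuous_map Cantor_space (discrete_topology UNIV) (\<lambda>x. x n)" for n
      using continuous_map_id[of Cantor_space] unfolding continuous_map_Cantor_space id_def by blast
    have "continuous_map Cantor_space (discrete_topology {0, 1::real}) (\<lambda>x. of_bool (x n))" for n
      using continuous_map_compose[OF proj[of n], of "discrete_topology {0, 1::real}" of_bool]
      by (simp add: o_def)
    then show "continuous_map Cantor_space ?K (\<lambda>x n. of_bool (x n))"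
      by (simp add: continuous_map_componentwise_UNIV)
    have "continuous_map ?K (discrete_topology {0, 1::real}) (\<lambda>y. y n)" for n
      by (rule continuous_map_product_projection) simp
    from continuous_map_compose[OF this, of "discrete_topology UNIV" "\<lambda>r. r = 1"]
    have "continuous_map ?K (discrete_topology UNIV) (\<lambda>y. y n = 1)" for n
      by (simp add: o_def)
    then show "continuous_map ?K Cantor_space (\<lambda>y n. y n = 1)"
      by (simp add: continuous_map_Cantor_space)
  qed (auto simp: PiE_iff fun_eq_iff)
  then show ?thesis by (auto simp: homeomorphic_space_def)
qed

lemma greatest_ambit_inverse_limit_of_Cantor_spaces:
  fixes G :: "'g monoid" and T :: "'g topology"
  assumes "Polish_group G T" and na: "non_archimedean G T"
  shows "\<exists>(I :: ('g \<Rightarrow> complex) set set) leq (X :: ('g \<Rightarrow> complex) set \<Rightarrow> (nat \<Rightarrow> real) topology) act p h.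
    G_inverse_system G T I leq X act p \<and> (\<forall>i\<in>I. X i homeomorphic_space Cantor_space) \<and>
    G_isomorphism G (greatest_ambit_top G T) (greatest_ambit_act G T)
      (inv_limit_top I leq X p) (inv_limit_act I act) h"
proof -
  have "topological_group G T" and sep: "separable_space T"
    using assms(1) by (auto simp: Polish_group_def Polish_space_def)
  then interpret topological_group_on G T
    by (simp add: topological_group_on_def topological_group_on_axioms_def topological_group_def)
  let ?I = "{E. finite E \<and> E \<subseteq> RUCB G T}"
  \<comment> \<open>The theorem asks for spaces on the type \<open>nat => real\<close>;
    \<open>K\<close> is a copy of the Cantor space there, onto which every thickened quotient is
    moved.\<close>
  define K where "K = product_topology (\<lambda>_::nat. discrete_topology {0, 1::real}) UNIV"
  have K: "K homeomorphic_space Cantor_space"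
    unfolding K_def
    using Cantor_space_homeomorphic_real_sequences by (rule homeomorphic_space_sym[THEN iffD1])
  have "\<exists>u v. homeomorphic_maps (thick E) K u v" if "E \<in> ?I" for E
  proof -
    have "thick E homeomorphic_space Cantor_space"
      using thick_homeomorphic_Cantor_space[OF sep] that by simp
    also have "Cantor_space homeomorphic_space K"
      using K by (rule homeomorphic_space_sym[THEN iffD1])
    finally have "thick E homeomorphic_space K" .
    then show ?thesis by (simp add: homeomorphic_space_def)
  qed
  then obtain u v where uv: "\<And>E. E \<in> ?I \<Longrightarrow> homeomorphic_maps (thick E) K (u E) (v E)" by metis
  let ?act = "\<lambda>E g x. u E (thick_act E g (v E x))"
  let ?p = "\<lambda>F E x. u E (thick_bond F E (v F x))"
  \<comment> \<open>The Cantor coordinate is set to the value to which proper bonds collapse, so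
    these maps commute with the bonds.\<close>
  let ?c = "\<lambda>E \<phi>. (restrict \<phi> (orbits E), \<lambda>_::nat. False)"
  have sys: "G_inverse_system G T ?I (\<subseteq>) (\<lambda>_. K) ?act ?p"
    using G_inverse_system_transport[OF G_inverse_system_thick uv] .
  have u: "continuous_map (thick E) K (u E)" and v: "continuous_map K (thick E) (v E)"
    and vu: "\<And>y. y \<in> topspace (thick E) \<Longrightarrow> v E (u E y) = y" if "E \<in> ?I" for E
    using uv[OF that] by (auto simp: homeomorphic_maps_def)
  have c_in: "?c E \<phi> \<in> topspace (thick E)" if "\<phi> \<in> ambit" for E \<phi>
    using that by (simp add: topspace_thick topspace_ambit_quot)
  have "G_isomorphism G (greatest_ambit_top G T) (greatest_ambit_act G T)
      (inv_limit_top ?I (\<subseteq>) (\<lambda>_. K) ?p) (inv_limit_act ?I ?act) (\<lambda>\<phi>. \<lambda>E\<in>?I. u E (?c E \<phi>))"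
  proof (rule G_isomorphism_inv_limit[OF sys compact_ambit], unfold topspace_ambit)
    show "Hausdorff_space K" by (simp add: K_def Hausdorff_space_product_topology)
    fix E assume E: "E \<in> ?I"
    have "continuous_map (greatest_ambit_top G T) (thick E) (?c E)"
      unfolding thick_def by (intro continuous_map_pairedI continuous_map_ambit_quot) simp
    from continuous_map_compose[OF this u[OF E]]
    show "continuous_map (greatest_ambit_top G T) K (\<lambda>\<phi>. u E (?c E \<phi>))" by (simp add: o_def)
    show "equivariant G (greatest_ambit_top G T) (greatest_ambit_act G T) (?act E) (\<lambda>\<phi>. u E (?c E \<phi>))"
      by (simp add: equivariant_def topspace_ambit vu[OF E c_in] thick_act_def ambit_quot_act_restrict)
    \<comment> \<open>Adjoining a function outside \<open>E\<close> gives a proper bond. Each of its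
      values is a restricted character paired with the collapsed coordinate, hence the image of a
      character.\<close>
    obtain f where f: "f \<in> RUCB G T" "f \<notin> E"
      using infinite_RUCB E by (metis (mono_tags) finite_subset mem_Collect_eq subsetI)
    let ?F = "insert f E"
    have F: "?F \<in> ?I" "E \<subseteq> ?F" "E \<noteq> ?F" using E f by auto
    have "?p ?F E x \<in> (\<lambda>\<phi>. u E (?c E \<phi>)) ` ambit" if "x \<in> topspace K" for x
    proof -
      have "v ?F x \<in> topspace (thick ?F)"
        using v[OF F(1)] that by (auto simp: continuous_map_def)
      then obtain \<phi> where \<phi>: "\<phi> \<in> ambit" "fst (v ?F x) = restrict \<phi> (orbits ?F)"
        by (auto simp: topspace_thick topspace_ambit_quot mem_Times_iff)
      have "orbits ?F \<inter> orbits E = orbits E" using orbits_mono[OF F(2)] by blast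
      then have "thick_bond ?F E (v ?F x) = ?c E \<phi>" using F(3) \<phi>(2) by (simp add: thick_bond_def)
      then show ?thesis using \<phi>(1) by simp
    qed
    then show "\<exists>F\<in>?I. E \<subseteq> F \<and> ?p F E ` topspace K \<subseteq> (\<lambda>\<phi>. u E (?c E \<phi>)) ` ambit"
      using F(1,2) by blast
  next
    fix E F \<phi> assume EF: "E \<in> ?I" "F \<in> ?I" "E \<subseteq> F" "\<phi> \<in> ambit"
    have "orbits F \<inter> orbits E = orbits E" using orbits_mono[OF EF(3)] by blast
    then have "thick_bond F E (?c F \<phi>) = ?c E \<phi>" by (auto simp: thick_bond_def)
    then show "?p F E (u F (?c F \<phi>)) = u E (?c E \<phi>)" by (simp add: vu[OF EF(2) c_in[OF EF(4)]])
  next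
    fix \<phi> \<psi> assume \<phi>: "\<phi> \<in> ambit" and \<psi>: "\<psi> \<in> ambit"
      and eq: "\<And>E. E \<in> ?I \<Longrightarrow> u E (?c E \<phi>) = u E (?c E \<psi>)"
    show "\<phi> = \<psi>"
    proof (rule ambit_eqI[OF na \<phi> \<psi>])
      fix f assume f: "f \<in> idems"
      \<comment> \<open>A singleton index suffices: its orbit set contains \<open>f\<close> itself,
        so equal images at this index give equal values at \<open>f\<close>.\<close>
      then have I: "{f} \<in> ?I" by (simp add: idems_RUCB)
      have "?c {f} \<phi> = ?c {f} \<psi>" using eq[OF I] vu[OF I c_in[OF \<phi>]] vu[OF I c_in[OF \<psi>]] by metis
      then have "restrict \<phi> (orbits {f}) f = restrict \<psi> (orbits {f}) f" by simp
      then show "\<phi> f = \<psi> f" using subset_orbits[of f "{f}"] f by simp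
    qed
  qed
  with sys K show ?thesis by blast
qed

theorem theorem2p2p14:
  fixes G :: "'g monoid" and T :: "'g topology"
  assumes "Polish_group G T" and "non_archimedean G T"
  shows "(\<exists>(I :: ('g \<Rightarrow> complex) set set) leq (X :: ('g \<Rightarrow> complex) set \<Rightarrow> (nat \<Rightarrow> real) topology) act p h.
            G_inverse_system G T I leq X act p \<and>
            (\<forall>i\<in>I. compact_space (X i) \<and> metrizable_space (X i) \<and> covering_dim_zero (X i)) \<and>
            G_isomorphism G (greatest_ambit_top G T) (greatest_ambit_act G T)
              (inv_limit_top I leq X p) (inv_limit_act I act) h)
       \<and> (infinite (carrier G) \<longrightarrow>
          (\<exists>(I :: ('g \<Rightarrow> complex) set set) leq (X :: ('g \<Rightarrow> complex) set \<Rightarrow> (nat \<Rightarrow> real) topology) act p h.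
            G_inverse_system G T I leq X act p \<and>
            (\<forall>i\<in>I. compact_space (X i) \<and> metrizable_space (X i) \<and> covering_dim_zero (X i) \<and>
                    X i homeomorphic_space Cantor_space) \<and>
            G_isomorphism G (greatest_ambit_top G T) (greatest_ambit_act G T)
              (inv_limit_top I leq X p) (inv_limit_act I act) h))"
proof -
  obtain I :: "('g \<Rightarrow> complex) set set" and leq
    and X :: "('g \<Rightarrow> complex) set \<Rightarrow> (nat \<Rightarrow> real) topology" and act p h
    where sys: "G_inverse_system G T I leq X act p"
      and X: "\<And>i. i \<in> I \<Longrightarrow> X i homeomorphic_space Cantor_space"
      and iso: "G_isomorphism G (greatest_ambit_top G T) (greatest_ambit_act G T)
        (inv_limit_top I leq X p) (inv_limit_act I act) h"
    using greatest_ambit_inverse_limit_of_Cantor_spaces[OF assms] by (elim exE conjE) blast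
  have "compact_space (X i) \<and> metrizable_space (X i) \<and> covering_dim_zero (X i)" if "i \<in> I" for i
    using X[OF that] compact_Cantor_space metrizable_Cantor_space covering_dim_zero_Cantor_space
      homeomorphic_compact_space homeomorphic_metrizable_space covering_dim_zero_homeomorphic
    by blast
  then show ?thesis using sys X iso by (intro conjI impI exI) auto
qed

end
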